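(* Let the smoothness parameters $\alpha>\frac12$ and $\beta\le0$ with $\alpha+\beta>\frac12$, the dimension $d\in\mathbb{N}$, $d\ge2$, and the refinement $R\ge1$ be given. Assume that $\Lambda(\boldsymbol z,M)$ is a reconstructing rank-1 lattice for $H_R^{d,T}$ with $T:=-\frac\beta\alpha$ constructed by the CBC strategy. Then $$\big\|\mathrm{Id}-S_{H_R^{d,T}}^{\Lambda(\boldsymbol z,M)}\big|\mathcal{H}^{\alpha,\beta}(\mathbb{T}^d)\to L_\infty(\mathbb{T}^d)\big\|\lesssim 2^{-(\alpha+\beta-\frac12)R}\begin{cases}R^{\frac{d-1}{2}}&:\ \beta=0,\\1&:\ \beta<0\end{cases}$$ $$\lesssim M^{-(\alpha+\beta-\frac12)/2}\begin{cases}(\log M)^{\frac{d-2}{2}(\alpha-\frac12)+\frac{d-1}{2}}&:\ \beta=0,\\1&:\ \beta<0.\end{cases}$$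
   Context: $\mathbb{T}=[0,1)$ is the torus, $\hat f_{\boldsymbol k}=\int_{\mathbb{T}^d}f(\boldsymbol x)e^{-2\pi i\boldsymbol k\cdot\boldsymbol x}\,d\boldsymbol x$. For real $\alpha,\beta$, $\mathcal{H}^{\alpha,\beta}(\mathbb{T}^d)$ is the space of $f\in L_2(\mathbb{T}^d)$ with finite norm $$\|f|\mathcal{H}^{\alpha,\beta}(\mathbb{T}^d)\|^2=\sum_{\boldsymbol k\in\mathbb{Z}^d}|\hat f_{\boldsymbol k}|^2(1+\|\boldsymbol k\|_2^2)^{\beta}\prod_{s=1}^d(1+|k_s|^2)^{\alpha}.$$ Under the hypotheses elements of $\mathcal{H}^{\alpha,\beta}(\mathbb{T}^d)$ are continuous (after choosing the continuous representative). Generalized hyperbolic cross: $Q_0=\{-1,0,1\}$, $Q_j=([-2^j,-2^{j-1}-1]\cup[2^{j-1}+1,2^j])\cap\mathbb{Z}$ for $j\ge1$, $Q_{\boldsymbol j}=Q_{j_1}\times\dots\times Q_{j_d}$; for $T\in[0,1)$, $J_R^{d,T}=\{\boldsymbol j\in\mathbb{N}_0^d:\|\boldsymbol j\|_1-T\|\boldsymbol j\|_\infty\le(1-T)R+d-1\}$ and $H_R^{d,T}=\bigcup_{\boldsymbol j\in J_R^{d,T}}Q_{\boldsymbol j}$. For $\boldsymbol z\in\mathbb{Z}^d$, $M\in\mathbb{N}$, the rank-1 lattice with generating vector $\boldsymbol z$ and size $M$ is $\Lambda(\boldsymbol z,M)=\{\frac jM\boldsymbol z\bmod\boldsymbol 1:j=0,\dots,M-1\}$.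 For finite $I\subset\mathbb{Z}^d$ the sampling operator is $$S_I^{\Lambda(\boldsymbol z,M)}f=\sum_{\boldsymbol k\in I}\hat f_{\boldsymbol k}^{\Lambda(\boldsymbol z,M)}e^{2\pi i\boldsymbol k\cdot\circ},\qquad \hat f_{\boldsymbol k}^{\Lambda(\boldsymbol z,M)}=\frac1M\sum_{j=0}^{M-1}f\big(\tfrac jM\boldsymbol z\big)e^{-2\pi i\frac jM\boldsymbol k\cdot\boldsymbol z}.$$ $\Lambda(\boldsymbol z,M)$ is a reconstructing rank-1 lattice for $I$ if $S_I^{\Lambda(\boldsymbol z,M)}p=p$ for all trigonometric polynomials $p$ with frequencies in $I$; equivalently $\boldsymbol k^1\cdot\boldsymbol z\not\equiv\boldsymbol k^2\cdot\boldsymbol z\pmod M$ for all distinct $\boldsymbol k^1,\boldsymbol k^2\in I$. The CBC (component-by-component) strategy is the search algorithm of Table 3.1 in L. Kämmerer's dissertation: it constructs the generating vector $\boldsymbol z$ of a reconstructing rank-1 lattice component by component, iteratively increasing the dimension of the index set for which the reconstruction property should hold. With it one can explicitly construct reconstructing rank-1 lattices for $H_R^{d,T}$ of size $M\ge2^{2R-2}$ with $M\lesssim 2^{2R}R^{d-2}$ if $T=0$ and $M\lesssim2^{2R}$ if $T>0$. $\|A|X\to Y\|$ is the operator norm; $a\lesssim b$ means $a\le c\,b$ with a constant $c>0$ independent of $R,\boldsymbol z,M$. *)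

theory Defs
  imports "HOL-Analysis.Analysis" "HOL-Probability.Essential_Supremum"
begin

section \<open>Functions on the torus and spaces of hybrid mixed smoothness\<close>

text \<open>The dimension \<open>d\<close> is \<open>CARD('n)\<close>. Functions on the torus are functions on
  \<open>real ^ 'n\<close> that have period one in every coordinate; \<open>torus_measure\<close> is Lebesgue
  measure on the fundamental domain \<open>[0,1)^d\<close>.\<close>

definition of_int_vec :: "int ^ 'n \<Rightarrow> real ^ 'n" where
  "of_int_vec k = (\<chi> i. of_int (k $ i))"

definition periodic :: "(real ^ 'n \<Rightarrow> complex) \<Rightarrow> bool" where
  "periodic f \<longleftrightarrow> (\<forall>x k. f (x + of_int_vec k) = f x)"

definition torus_measure :: "(real ^ 'n) measure" where
  "torus_measure = lebesgue_on {x. \<forall>i. 0 \<le> x $ i \<and> x $ i < 1}"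

definition torus_char :: "int ^ 'n \<Rightarrow> real ^ 'n \<Rightarrow> complex" where
  "torus_char k x = cis (2 * pi * (of_int_vec k \<bullet> x))"

definition fourier_coeff :: "(real ^ 'n \<Rightarrow> complex) \<Rightarrow> int ^ 'n \<Rightarrow> complex" where
  "fourier_coeff f k = (LINT x|torus_measure. f x * cnj (torus_char k x))"

definition L2_torus :: "(real ^ 'n \<Rightarrow> complex) set" where
  "L2_torus = {f. periodic f \<and> f \<in> borel_measurable torus_measure \<and>
                  integrable torus_measure (\<lambda>x. (norm (f x))\<^sup>2)}"

definition Linf_norm :: "(real ^ 'n \<Rightarrow> complex) \<Rightarrow> ennreal" where
  "Linf_norm f = esssup torus_measure (\<lambda>x. ennreal (norm (f x)))"

definition hybrid_weight :: "real \<Rightarrow> real \<Rightarrow> int ^ 'n \<Rightarrow> real" where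
  "hybrid_weight \<alpha> \<beta> k =
     (1 + (\<Sum>i\<in>UNIV. (real_of_int (k $ i))\<^sup>2)) powr \<beta> *
     (\<Prod>i\<in>UNIV. (1 + (real_of_int (k $ i))\<^sup>2) powr \<alpha>)"

definition hybrid_space :: "real \<Rightarrow> real \<Rightarrow> (real ^ 'n \<Rightarrow> complex) set" where
  "hybrid_space \<alpha> \<beta> = {f \<in> L2_torus.
     (\<lambda>k. (norm (fourier_coeff f k))\<^sup>2 * hybrid_weight \<alpha> \<beta> k) summable_on UNIV}"

definition hybrid_norm :: "real \<Rightarrow> real \<Rightarrow> (real ^ 'n \<Rightarrow> complex) \<Rightarrow> real" where
  "hybrid_norm \<alpha> \<beta> f =
     sqrt (\<Sum>\<^sub>\<infinity>k\<in>UNIV. (norm (fourier_coeff f k))\<^sup>2 * hybrid_weight \<alpha> \<beta> k)"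

text \<open>Operator norm of \<open>A\<close> from the hybrid space to \<open>L\<^sub>\<infinity>\<close>. Elements of the
  hybrid space are classes of functions up to null sets; point evaluations are taken in the
  continuous representative, so the supremum runs over the continuous representatives.
  It is formed in \<open>ennreal\<close>, so an unbounded \<open>A\<close> has norm \<open>\<infinity>\<close>.\<close>

definition hybrid_Linf_opnorm ::
  "real \<Rightarrow> real \<Rightarrow> ((real ^ 'n \<Rightarrow> complex) \<Rightarrow> (real ^ 'n \<Rightarrow> complex)) \<Rightarrow> ennreal" where
  "hybrid_Linf_opnorm \<alpha> \<beta> A =
     (SUP f \<in> {f \<in> hybrid_space \<alpha> \<beta>. continuous_on UNIV f \<and> hybrid_norm \<alpha> \<beta> f \<le> 1}.
        Linf_norm (A f))"


section \<open>Generalized hyperbolic crosses\<close>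

definition dyadic_block :: "nat \<Rightarrow> int set" where
  "dyadic_block j = (if j = 0 then {-1, 0, 1}
     else {-(2 ^ j) .. -(2 ^ (j - 1)) - 1} \<union> {2 ^ (j - 1) + 1 .. 2 ^ j})"

definition hc_levels :: "real \<Rightarrow> real \<Rightarrow> (nat ^ 'n) set" where
  "hc_levels T R = {j.
     real (\<Sum>i\<in>UNIV. j $ i) - T * real (Max (range (\<lambda>i. j $ i)))
       \<le> (1 - T) * R + real CARD('n) - 1}"

definition hyperbolic_cross :: "real \<Rightarrow> real \<Rightarrow> (int ^ 'n) set" where
  "hyperbolic_cross T R =
     (\<Union>j \<in> hc_levels T R. {k. \<forall>i. k $ i \<in> dyadic_block (j $ i)})"


section \<open>Rank-1 lattice sampling\<close>

definition int_dot :: "int ^ 'n \<Rightarrow> int ^ 'n \<Rightarrow> int" where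
  "int_dot k z = (\<Sum>i\<in>UNIV. k $ i * z $ i)"

text \<open>The node \<open>(j/M) z\<close> is not reduced modulo 1, since it is only used
  with periodic functions.\<close>

definition lattice_node :: "int ^ 'n \<Rightarrow> nat \<Rightarrow> nat \<Rightarrow> real ^ 'n" where
  "lattice_node z M j = (real j / real M) *\<^sub>R of_int_vec z"

definition lattice_coeff ::
  "int ^ 'n \<Rightarrow> nat \<Rightarrow> (real ^ 'n \<Rightarrow> complex) \<Rightarrow> int ^ 'n \<Rightarrow> complex" where
  "lattice_coeff z M f k =
     (1 / of_nat M) *
     (\<Sum>j<M. f (lattice_node z M j) * cnj (torus_char k (lattice_node z M j)))"

definition lattice_sampling ::
  "(int ^ 'n) set \<Rightarrow> int ^ 'n \<Rightarrow> nat \<Rightarrow> (real ^ 'n \<Rightarrow> complex) \<Rightarrow> (real ^ 'n \<Rightarrow> complex)" where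
  "lattice_sampling I z M f = (\<lambda>x. \<Sum>k\<in>I. lattice_coeff z M f k * torus_char k x)"

definition reconstructing_lattice :: "(int ^ 'n) set \<Rightarrow> int ^ 'n \<Rightarrow> nat \<Rightarrow> bool" where
  "reconstructing_lattice I z M \<longleftrightarrow>
     (\<forall>a :: int ^ 'n \<Rightarrow> complex.
        lattice_sampling I z M (\<lambda>x. \<Sum>k\<in>I. a k * torus_char k x)
          = (\<lambda>x. \<Sum>k\<in>I. a k * torus_char k x))"

text \<open>Component-by-component search. The components are processed in the linear order of the
  index type. In step \<open>s\<close>, with the earlier components of \<open>z\<close> fixed, the search accepts a
  value \<open>z $ s\<close> in \<open>{0, ..., M - 1}\<close> if the number of residues \<open>k \<cdot> (z_1, ..., z_s) mod M\<close>
  for \<open>k\<close> in the projection \<open>I_s\<close> of \<open>I\<close> to the first \<open>s\<close> coordinates is \<open>|I_s|\<close>.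
  The projection is represented by filling up with zeros. The predicate
  describes all possible outputs of the search, whichever admissible value is picked.\<close>

definition cbc_projection ::
  "'n::{finite,linorder} \<Rightarrow> (int, 'n) vec \<Rightarrow> (int, 'n) vec" where
  "cbc_projection s k = (\<chi> i. if i \<le> s then k $ i else 0)"

definition cbc_constructed ::
  "(int, 'n::{finite,linorder}) vec set \<Rightarrow> (int, 'n) vec \<Rightarrow> nat \<Rightarrow> bool" where
  "cbc_constructed I z M \<longleftrightarrow>
     (\<forall>s. z $ s \<in> {0..<int M} \<and>
          card ((\<lambda>k. int_dot k z mod int M) ` (cbc_projection s ` I))
            = card (cbc_projection s ` I))"

text \<open>The size guarantee that accompanies the component-by-component construction for
  hyperbolic crosses, \<open>M \<lesssim> 2^(2R) R^(d-2)\<close> for \<open>T = 0\<close> and \<open>M \<lesssim> 2^(2R)\<close> for \<open>T > 0\<close>,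
  with implied constant \<open>C\<close>. The search itself takes \<open>M\<close> as an input.\<close>

definition cbc_size_bound :: "real \<Rightarrow> nat \<Rightarrow> real \<Rightarrow> real \<Rightarrow> nat \<Rightarrow> bool" where
  "cbc_size_bound C d T R M \<longleftrightarrow>
     real M \<le> C * 2 powr (2 * R) * (if T = 0 then R powr (real d - 2) else 1)"

end

theory Submission
  imports Defs
begin

text \<open>Writing \<open>f\<close> as its absolutely convergent Fourier series, it suffices to control the error on
  single characters. The sampling operator reproduces characters with frequency in the cross \<open>H\<close>,
  and maps any other character to zero or to one single character, because distinct frequencies in
  \<open>H\<close> are never aliased to each other. Hence the uniform error is at most twice the sum of
  \<open>|f\<^sub>k|\<close> over \<open>k\<close> outside \<open>H\<close>, and Cauchy-Schwarz reduces the upper bound to a tail estimate for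
  the reciprocal weights. The tail is summed over dyadic levels: one first sums the geometric series
  in the largest level \<open>m\<close>, which starts at about \<open>R - r / (1 - T)\<close> when the other levels add up to
  \<open>r\<close>, and what remains is a product of convergent geometric series, of ratio \<open>2\<^sup>-\<^sup>\<delta>\<close> with
  \<open>\<delta>\<close> fixed if \<open>\<beta> < 0\<close> and \<open>\<delta>\<close> of order \<open>1 / R\<close> if \<open>\<beta> = 0\<close>; the latter accounts for the factor
  \<open>R\<^sup>d\<^sup>-\<^sup>1\<close>. For the bound in terms of \<open>M\<close>, injectivity modulo \<open>M\<close> on the cross forces \<open>M \<ge> 2\<^sup>R\<close>,
  so that \<open>R\<close> is at most a constant times \<open>ln M\<close>.\<close>

section \<open>Dyadic levels and the tail of the reciprocal weights\<close>

text \<open>Each integer lies in exactly one \<open>dyadic_block\<close>, and this is the index of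
  that block. Level 0 collects -1, 0 and 1.\<close>

definition dyadic_level :: "int \<Rightarrow> nat" where
  "dyadic_level k = (LEAST j. \<bar>k\<bar> \<le> 2 ^ j)"

lemma abs_le_dyadic_level: "\<bar>k\<bar> \<le> 2 ^ dyadic_level k"
proof -
  have "k < 2 ^ nat \<bar>k\<bar>" for k :: int
    by (cases "k \<ge> 0") (use of_nat_less_two_power[where 'a = int, of "nat k"] in auto, smt (verit) zero_less_power)
  from this[of "\<bar>k\<bar>"] have "\<bar>k\<bar> \<le> 2 ^ nat \<bar>k\<bar>"
    by simp
  then show ?thesis
    unfolding dyadic_level_def by (rule LeastI)
qed

lemma dyadic_level_lower:
  assumes "dyadic_level k = Suc j"
  shows "2 ^ j < \<bar>k\<bar>"
  using not_less_Least[of j "\<lambda>j. \<bar>k\<bar> \<le> 2 ^ j"] assms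
  by (simp add: dyadic_level_def not_le)

lemma mem_dyadic_block_level: "k \<in> dyadic_block (dyadic_level k)"
proof (cases "dyadic_level k")
  case 0
  then show ?thesis
    using abs_le_dyadic_level[of k] by (auto simp: dyadic_block_def)
next
  case (Suc j)
  then show ?thesis
    using abs_le_dyadic_level[of k] dyadic_level_lower[OF Suc] by (auto simp: dyadic_block_def)
qed

lemma square_le_dyadic_level: "(real_of_int k)\<^sup>2 \<le> 4 ^ dyadic_level k"
proof -
  have "\<bar>real_of_int k\<bar> \<le> 2 ^ dyadic_level k"
    using abs_le_dyadic_level[of k] by (metis of_int_abs of_int_le_numeral_power_cancel_iff)
  then have "\<bar>real_of_int k\<bar>\<^sup>2 \<le> (2 ^ dyadic_level k)\<^sup>2"
    by (intro power_mono) auto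
  then show ?thesis
    by (simp add: power2_eq_square flip: power_mult_distrib)
qed

text \<open>On level j + 1 the absolute value exceeds 2 ^ j, which loses a factor 4 after squaring;
  on level 0 the summand 1 suffices.\<close>

lemma dyadic_level_le_square: "4 ^ dyadic_level k \<le> 4 * (1 + (real_of_int k)\<^sup>2)"
proof (cases "dyadic_level k")
  case (Suc j)
  have "2 ^ j \<le> \<bar>real_of_int k\<bar>"
    using dyadic_level_lower[OF Suc]
    by (metis less_imp_le of_int_abs of_int_le_iff of_int_numeral of_int_power)
  then have "(2 ^ j)\<^sup>2 \<le> \<bar>real_of_int k\<bar>\<^sup>2"
    by (intro power_mono) auto
  then show ?thesis
    by (simp add: Suc power2_eq_square flip: power_mult_distrib)
qed simp

text \<open>Counting the whole interval of 2 * 2 ^ l + 1 integers instead of the block costs only a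
  constant factor.\<close>

lemma card_dyadic_level_le: "card {k \<in> A. dyadic_level k = l} \<le> 3 * 2 ^ l"
proof -
  have "{k \<in> A. dyadic_level k = l} \<subseteq> {- (2 ^ l)..2 ^ l}"
  proof
    fix k assume "k \<in> {k \<in> A. dyadic_level k = l}"
    then show "k \<in> {- (2 ^ l)..2 ^ l}"
      using abs_le_dyadic_level[of k] by (auto simp: abs_le_iff)
  qed
  then have "card {k \<in> A. dyadic_level k = l} \<le> card {- (2 ^ l)..(2 ^ l :: int)}"
    by (intro card_mono) auto
  also have "\<dots> = 2 * 2 ^ l + 1"
    by (simp add: nat_add_distrib nat_mult_distrib nat_power_eq)
  also have "\<dots> \<le> 3 * 2 ^ l"
    by simp
  finally show ?thesis .
qed

section \<open>Geometric sums over levels and level vectors\<close>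

text \<open>Factoring out the power at the first admissible integer \<open>N\<close> leaves a part
  of the full geometric series. The threshold is real and may be negative; then \<open>N\<close> is
  0 and the bound still holds.\<close>

lemma sum_geometric_tail_le:
  fixes e x :: real
  assumes "e > 0" "finite L" "\<And>l. l \<in> L \<Longrightarrow> x \<le> real l"
  shows "(\<Sum>l\<in>L. 2 powr (- e * real l)) \<le> 2 powr (- e * x) / (1 - 2 powr (- e))"
proof -
  define q :: real where "q = 2 powr (- e)"
  define N where "N = nat \<lceil>x\<rceil>"
  have q: "0 < q" "q < 1"
    using assms(1) by (auto simp: q_def powr_less_one)
  have pw: "2 powr (- e * real l) = q ^ l" for l
    by (simp add: q_def powr_powr flip: powr_realpow)
  have "L \<subseteq> (+) N ` UNIV"
  proof
    fix l assume "l \<in> L"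
    then have "N \<le> l"
      using assms(3)[of l] by (simp add: N_def ceiling_le_iff)
    then show "l \<in> (+) N ` UNIV"
      by (metis le_Suc_ex rangeI)
  qed
  then obtain L' where L': "L = (+) N ` L'" "finite L'"
    by (metis assms(2) finite_image_iff inj_on_add subset_image_inj)
  have "(\<Sum>l\<in>L. 2 powr (- e * real l)) = q ^ N * (\<Sum>l\<in>L'. q ^ l)"
    unfolding pw by (simp add: L' sum.reindex power_add sum_distrib_left)
  also have "\<dots> \<le> q ^ N * (1 / (1 - q))"
    using q L' sum_le_suminf[of "\<lambda>l. q ^ l" L'] suminf_geometric[of q]
    by (intro mult_left_mono) (auto simp: summable_geometric)
  also have "q ^ N \<le> 2 powr (- e * x)"
  proof -
    have "x \<le> real N"
      by (simp add: N_def) linarith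
    then show ?thesis
      using assms(1) by (simp flip: pw)
  qed
  then have "q ^ N * (1 / (1 - q)) \<le> 2 powr (- e * x) * (1 / (1 - q))"
    using q by (intro mult_right_mono) auto
  finally show ?thesis
    by (simp add: q_def)
qed

text \<open>Grouping by level, the extra 1 in the exponent pays for the at most 3 * 2 ^ l integers
  of level l. The bound does not depend on the finite set A, so it can stand in for the infinite
  series.\<close>

lemma sum_dyadic_level_tail_le:
  fixes e x :: real
  assumes "e > 0" "finite A"
  shows "(\<Sum>k\<in>{k \<in> A. x \<le> real (dyadic_level k)}. 2 powr (- (e + 1) * real (dyadic_level k)))
    \<le> 3 / (1 - 2 powr (- e)) * 2 powr (- e * x)"
proof -
  define B where "B = {k \<in> A. x \<le> real (dyadic_level k)}"
  have fin: "finite B"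
    using assms by (simp add: B_def)
  have "(\<Sum>k\<in>B. 2 powr (- (e + 1) * real (dyadic_level k)))
    = (\<Sum>l\<in>dyadic_level ` B. \<Sum>k\<in>{k \<in> B. dyadic_level k = l}. 2 powr (- (e + 1) * real (dyadic_level k)))"
    by (rule sum.image_gen) fact
  also have "\<dots> \<le> (\<Sum>l\<in>dyadic_level ` B. 3 * 2 powr (- e * real l))"
  proof (rule sum_mono)
    fix l
    have "(\<Sum>k\<in>{k \<in> B. dyadic_level k = l}. 2 powr (- (e + 1) * real (dyadic_level k)))
      = real (card {k \<in> B. dyadic_level k = l}) * 2 powr (- (e + 1) * real l)"
      by simp
    also have "\<dots> \<le> real (3 * 2 ^ l) * 2 powr (- (e + 1) * real l)"
      using card_dyadic_level_le by (intro mult_right_mono of_nat_mono) auto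
    also have "\<dots> = 3 * (2 powr real l * 2 powr (- (e + 1) * real l))"
      by (simp add: powr_realpow)
    also have "\<dots> = 3 * 2 powr (- e * real l)"
      by (simp add: algebra_simps flip: powr_add)
    finally show "(\<Sum>k\<in>{k \<in> B. dyadic_level k = l}. 2 powr (- (e + 1) * real (dyadic_level k)))
      \<le> 3 * 2 powr (- e * real l)" .
  qed
  also have "\<dots> = 3 * (\<Sum>l\<in>dyadic_level ` B. 2 powr (- e * real l))"
    by (simp add: sum_distrib_left)
  also have "\<dots> \<le> 3 * (2 powr (- e * x) / (1 - 2 powr (- e)))"
    using fin assms(1) by (intro mult_left_mono sum_geometric_tail_le) (auto simp: B_def)
  finally show ?thesis
    by (simp add: B_def)
qed

lemma finite_vec_box:
  assumes "finite A"
  shows "finite {k :: 'a ^ 'n::finite. \<forall>i. k $ i \<in> A}"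
proof (rule finite_subset)
  show "{k :: 'a ^ 'n. \<forall>i. k $ i \<in> A} \<subseteq> vec_lambda ` PiE UNIV (\<lambda>_. A)"
    by (auto intro!: image_eqI[where x = "vec_nth _"])
  show "finite (vec_lambda ` PiE UNIV (\<lambda>_. A) :: ('a ^ 'n) set)"
    using assms by (intro finite_imageI finite_PiE) auto
qed

text \<open>Separates one coordinate of a box from the others, so that the coordinate of largest
  level can be summed first.\<close>

lemma sum_vec_split_coordinate:
  fixes F :: "'a ^ 'n::finite \<Rightarrow> 'b::comm_monoid_add"
  shows "(\<Sum>k\<in>{k. \<forall>i. k $ i \<in> A}. F k)
    = (\<Sum>(g, m)\<in>PiE (- {s}) (\<lambda>_. A) \<times> A. F (\<chi> i. if i = s then m else g i))"
  by (rule sum.reindex_bij_witness[where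
        i = "\<lambda>(g, m). \<chi> i. if i = s then m else g i" and
        j = "\<lambda>k. (restrict (vec_nth k) (- {s}), k $ s)"])
     (auto simp: PiE_def extensional_def vec_eq_iff restrict_def fun_eq_iff
           split: if_splits cong: if_cong intro!: arg_cong[of _ _ F])

text \<open>Here s is the dominant coordinate, \<open>\<rho> k\<close> is the sum of the other
  levels and x gives the least dominant level allowed by that sum. Summing the dominant level gains
  2 powr (- a * x r); by \<open>thr\<close>, what is left decays in r at rate \<delta>, so the other
  coordinates contribute independent geometric series.\<close>

lemma sum_level_vectors_le:
  fixes a b \<delta> E :: real and s :: "'n::finite" and x :: "nat \<Rightarrow> real"
  assumes "finite A" "a > 0" "\<delta> > 0"
    and thr: "\<And>r. 2 powr (- b * real r) * 2 powr (- a * x r) \<le> E * 2 powr (- \<delta> * real r)"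
  defines "\<rho> \<equiv> \<lambda>k :: int ^ 'n. \<Sum>i\<in>- {s}. dyadic_level (k $ i)"
  shows "(\<Sum>k\<in>{k. (\<forall>i. k $ i \<in> A) \<and> x (\<rho> k) \<le> real (dyadic_level (k $ s))}.
      2 powr (- (a + 1) * real (dyadic_level (k $ s)) - (b + 1) * real (\<rho> k)))
    \<le> 3 / (1 - 2 powr (- a)) * E * (3 / (1 - 2 powr (- \<delta>))) ^ (CARD('n) - 1)"
proof -
  define r where "r g = (\<Sum>i\<in>- {s}. dyadic_level (g i))" for g :: "'n \<Rightarrow> int"
  have \<rho>: "\<rho> (\<chi> i. if i = s then m else g i) = r g" for m g
    unfolding \<rho>_def r_def by (rule sum.cong) auto
  have fin: "finite {k :: int ^ 'n. \<forall>i. k $ i \<in> A}"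
    using assms(1) by (rule finite_vec_box)
  have split: "2 powr (- (a + 1) * real m - (b + 1) * real n)
      = 2 powr (- (b + 1) * real n) * 2 powr (- (a + 1) * real m)" for m n
    unfolding powr_add[symmetric] by (rule arg_cong[where f = "(powr) 2"]) (simp add: algebra_simps)
  have C: "3 / (1 - 2 powr (- a)) > 0"
    using assms(2) by (simp add: powr_less_one)
  have "(\<Sum>k\<in>{k. (\<forall>i. k $ i \<in> A) \<and> x (\<rho> k) \<le> real (dyadic_level (k $ s))}.
      2 powr (- (a + 1) * real (dyadic_level (k $ s)) - (b + 1) * real (\<rho> k)))
    = (\<Sum>k\<in>{k. \<forall>i. k $ i \<in> A}. if x (\<rho> k) \<le> real (dyadic_level (k $ s))
        then 2 powr (- (a + 1) * real (dyadic_level (k $ s)) - (b + 1) * real (\<rho> k)) else 0)"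
    using fin by (simp add: sum.If_cases Int_def)
  also have "\<dots> = (\<Sum>g\<in>PiE (- {s}) (\<lambda>_. A). \<Sum>m\<in>A. if x (r g) \<le> real (dyadic_level m)
        then 2 powr (- (a + 1) * real (dyadic_level m) - (b + 1) * real (r g)) else 0)"
    unfolding sum_vec_split_coordinate[where s = s] sum.cartesian_product
    by (intro sum.cong refl) (clarsimp simp only: \<rho> split: prod.split, simp add: \<rho>)
  also have "\<dots> = (\<Sum>g\<in>PiE (- {s}) (\<lambda>_. A). 2 powr (- (b + 1) * real (r g)) *
        (\<Sum>m\<in>{m \<in> A. x (r g) \<le> real (dyadic_level m)}. 2 powr (- (a + 1) * real (dyadic_level m))))"
    using assms(1) unfolding split sum_distrib_left by (simp add: sum.If_cases Int_def)
  also have "\<dots> \<le> (\<Sum>g\<in>PiE (- {s}) (\<lambda>_. A). 2 powr (- (b + 1) * real (r g)) *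
        (3 / (1 - 2 powr (- a)) * 2 powr (- a * x (r g))))"
    using assms by (intro sum_mono mult_left_mono sum_dyadic_level_tail_le) auto
  \<comment> \<open>A factor 2 powr (- r) is set aside to pay for counting in the remaining
    coordinates; the inner bracket is the left-hand side of \<open>thr\<close>.\<close>
  also have "\<dots> = (\<Sum>g\<in>PiE (- {s}) (\<lambda>_. A). 3 / (1 - 2 powr (- a)) * (2 powr (- real (r g)) *
        (2 powr (- b * real (r g)) * 2 powr (- a * x (r g)))))"
    by (intro sum.cong refl) (simp add: algebra_simps flip: powr_add)
  also have "\<dots> \<le> (\<Sum>g\<in>PiE (- {s}) (\<lambda>_. A). 3 / (1 - 2 powr (- a)) * (2 powr (- real (r g)) *
        (E * 2 powr (- \<delta> * real (r g)))))"
    using C by (intro sum_mono mult_left_mono thr) auto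
  also have "\<dots> = 3 / (1 - 2 powr (- a)) * E * (\<Sum>g\<in>PiE (- {s}) (\<lambda>_. A). 2 powr (- (\<delta> + 1) * real (r g)))"
    by (simp add: sum_distrib_left algebra_simps flip: powr_add)
  also have "(\<Sum>g\<in>PiE (- {s}) (\<lambda>_. A). 2 powr (- (\<delta> + 1) * real (r g)))
    = (\<Sum>g\<in>PiE (- {s}) (\<lambda>_. A). \<Prod>i\<in>- {s}. 2 powr (- (\<delta> + 1) * real (dyadic_level (g i))))"
    by (simp add: r_def sum_distrib_left powr_sum)
  \<comment> \<open>Distributivity: the sum over all choice functions of a product is the product of
    the coordinate sums.\<close>
  also have "\<dots> = (\<Prod>i\<in>- {s}. \<Sum>m\<in>A. 2 powr (- (\<delta> + 1) * real (dyadic_level m)))"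
    using assms(1) by (subst prod_sum_PiE) auto
  also have "\<dots> = (\<Sum>m\<in>A. 2 powr (- (\<delta> + 1) * real (dyadic_level m))) ^ (CARD('n) - 1)"
    by (simp add: card_Diff_singleton Compl_eq_Diff_UNIV)
  finally have *: "(\<Sum>k\<in>{k. (\<forall>i. k $ i \<in> A) \<and> x (\<rho> k) \<le> real (dyadic_level (k $ s))}.
      2 powr (- (a + 1) * real (dyadic_level (k $ s)) - (b + 1) * real (\<rho> k)))
    \<le> 3 / (1 - 2 powr (- a)) * E * (\<Sum>m\<in>A. 2 powr (- (\<delta> + 1) * real (dyadic_level m))) ^ (CARD('n) - 1)" .
  \<comment> \<open>The sign of E is read off from \<open>thr\<close> at r = 0.\<close>
  have "0 \<le> E * 2 powr (- \<delta> * real 0)"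
    using thr[of 0] by (rule order_trans[rotated]) simp
  then have "0 \<le> E"
    by simp
  moreover have "(\<Sum>m\<in>A. 2 powr (- (\<delta> + 1) * real (dyadic_level m))) \<le> 3 / (1 - 2 powr (- \<delta>))"
    using sum_dyadic_level_tail_le[OF assms(3,1), of 0] by simp
  ultimately show ?thesis
    using C by (intro order_trans[OF *] mult_left_mono power_mono sum_nonneg) auto
qed

section \<open>Decay of the reciprocal weights\<close>

lemma hybrid_weight_pos: "hybrid_weight \<alpha> \<beta> k > 0"
proof -
  have "1 + (\<Sum>i\<in>UNIV. (real_of_int (k $ i))\<^sup>2) > 0"
    by (intro add_pos_nonneg sum_nonneg) auto
  moreover have "1 + (real_of_int (k $ i))\<^sup>2 \<noteq> 0" for i
    by (rule order.strict_implies_not_eq[symmetric]) (rule add_pos_nonneg, auto)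
  ultimately show ?thesis
    by (auto simp: hybrid_weight_def intro!: mult_pos_pos prod_pos)
qed

text \<open>If s carries the largest level l, the isotropic base is at most (1 + d) * 4 ^ l, which
  bounds its power from below because \<beta> \<le> 0. Each factor of the product is at least 4 powr
  (\<alpha> * (level - 1)). So the dominant level decays at rate 2 * (\<alpha> + \<beta>) and every
  other level at rate 2 * \<alpha>.\<close>

lemma inverse_hybrid_weight_le:
  fixes k :: "int ^ 'n::finite"
  assumes "\<alpha> \<ge> 0" "\<beta> \<le> 0" and max: "\<And>i. dyadic_level (k $ i) \<le> dyadic_level (k $ s)"
  shows "1 / hybrid_weight \<alpha> \<beta> k \<le> (1 + real CARD('n)) powr (- \<beta>) * 2 powr (2 * \<alpha> * real CARD('n)) *
    2 powr (- (2 * (\<alpha> + \<beta>)) * real (dyadic_level (k $ s))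
            - 2 * \<alpha> * real (\<Sum>i\<in>- {s}. dyadic_level (k $ i)))"
proof -
  define l where "l i = dyadic_level (k $ i)" for i
  have four: "(4::real) ^ n = 2 powr (2 * real n)" for n
    by (simp add: powr_realpow[symmetric] powr_powr[symmetric])
  have "1 + (\<Sum>i\<in>UNIV. (real_of_int (k $ i))\<^sup>2) \<le> 4 ^ l s + (\<Sum>i\<in>(UNIV :: 'n set). 4 ^ l s)"
    using max by (intro add_mono sum_mono order_trans[OF square_le_dyadic_level] power_increasing)
      (auto simp: l_def)
  also have "\<dots> = (1 + real CARD('n)) * 2 powr (2 * real (l s))"
    by (simp add: algebra_simps four)
  finally have "((1 + real CARD('n)) * 2 powr (2 * real (l s))) powr \<beta>
      \<le> (1 + (\<Sum>i\<in>UNIV. (real_of_int (k $ i))\<^sup>2)) powr \<beta>"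
    using assms(2) by (intro powr_mono2') (auto intro!: add_pos_nonneg sum_nonneg)
  then have W1: "(1 + real CARD('n)) powr \<beta> * 2 powr (2 * \<beta> * real (l s))
      \<le> (1 + (\<Sum>i\<in>UNIV. (real_of_int (k $ i))\<^sup>2)) powr \<beta>"
    by (simp add: powr_mult powr_powr mult_ac)
  have "(\<Prod>i\<in>(UNIV :: 'n set). 2 powr (2 * \<alpha> * real (l i) - 2 * \<alpha>))
      \<le> (\<Prod>i\<in>UNIV. (1 + (real_of_int (k $ i))\<^sup>2) powr \<alpha>)"
  proof (intro prod_mono conjI)
    fix i
    have "2 powr (2 * real (l i) - 2) \<le> 1 + (real_of_int (k $ i))\<^sup>2"
      using dyadic_level_le_square[of "k $ i"] by (simp add: powr_diff four l_def)
    then have "(2 powr (2 * real (l i) - 2)) powr \<alpha> \<le> (1 + (real_of_int (k $ i))\<^sup>2) powr \<alpha>"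
      using assms(1) by (intro powr_mono2) auto
    then show "2 powr (2 * \<alpha> * real (l i) - 2 * \<alpha>) \<le> (1 + (real_of_int (k $ i))\<^sup>2) powr \<alpha>"
      by (simp add: powr_powr algebra_simps)
  qed auto
  also have "(\<Prod>i\<in>(UNIV :: 'n set). 2 powr (2 * \<alpha> * real (l i) - 2 * \<alpha>))
      = 2 powr (\<Sum>i\<in>(UNIV :: 'n set). 2 * \<alpha> * real (l i) - 2 * \<alpha>)"
    by (simp add: powr_sum)
  also have "(\<Sum>i\<in>(UNIV :: 'n set). 2 * \<alpha> * real (l i) - 2 * \<alpha>)
      = 2 * \<alpha> * (\<Sum>i\<in>UNIV. real (l i)) - 2 * \<alpha> * real CARD('n)"
    by (simp add: sum_subtractf sum_distrib_left)
  also have "(\<Sum>i\<in>UNIV. real (l i)) = real (l s) + (\<Sum>i\<in>- {s}. real (l i))"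
    by (subst sum.remove[of _ s]) (auto simp: Compl_eq_Diff_UNIV)
  finally have W2: "2 powr (2 * \<alpha> * (real (l s) + (\<Sum>i\<in>- {s}. real (l i))) - 2 * \<alpha> * real CARD('n))
      \<le> (\<Prod>i\<in>UNIV. (1 + (real_of_int (k $ i))\<^sup>2) powr \<alpha>)" .
  define P where "P = ((1 + real CARD('n)) powr \<beta> * 2 powr (2 * \<beta> * real (l s))) *
      2 powr (2 * \<alpha> * (real (l s) + (\<Sum>i\<in>- {s}. real (l i))) - 2 * \<alpha> * real CARD('n))"
  have "P \<le> hybrid_weight \<alpha> \<beta> k"
    unfolding P_def hybrid_weight_def by (intro mult_mono W1 W2) auto
  moreover have "P > 0"
    by (simp add: P_def)
  ultimately have "1 / hybrid_weight \<alpha> \<beta> k \<le> 1 / P"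
    by (intro divide_left_mono) (auto intro: mult_pos_pos hybrid_weight_pos)
  also have "\<dots> = (1 + real CARD('n)) powr (- \<beta>) * (2 powr (- (2 * \<beta> * real (l s))) *
      2 powr (- (2 * \<alpha> * (real (l s) + (\<Sum>i\<in>- {s}. real (l i))) - 2 * \<alpha> * real CARD('n))))"
    unfolding P_def by (simp only: powr_minus divide_inverse inverse_mult_distrib mult_1_left mult.assoc)
  also have "\<dots> = (1 + real CARD('n)) powr (- \<beta>) * 2 powr (2 * \<alpha> * real CARD('n)) *
    2 powr (- (2 * (\<alpha> + \<beta>)) * real (l s) - 2 * \<alpha> * real (\<Sum>i\<in>- {s}. l i))"
    by (simp add: algebra_simps flip: powr_add)
  finally show ?thesis
    by (simp add: l_def)
qed

section \<open>Levels and finiteness of the hyperbolic cross\<close>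

lemma level_vector_notin_hc_levels:
  fixes k :: "int ^ 'n::finite"
  assumes "k \<notin> hyperbolic_cross T R"
  shows "(\<chi> i. dyadic_level (k $ i)) \<notin> hc_levels T R"
  using assms mem_dyadic_block_level by (force simp: hyperbolic_cross_def)

text \<open>The largest level m is at most the sum of all levels, so membership in
  \<open>hc_levels\<close> bounds (1 - T) * m. As T < 1, all levels are bounded and the cross lies
  in a finite box.\<close>

lemma finite_hyperbolic_cross:
  assumes "0 \<le> T" "T < 1"
  shows "finite (hyperbolic_cross T R :: (int ^ 'n::finite) set)"
proof -
  obtain N where N: "R + (real CARD('n) - 1) / (1 - T) \<le> real N"
    using real_arch_simple by blast
  have "hyperbolic_cross T R \<subseteq> {k :: int ^ 'n. \<forall>i. k $ i \<in> {- (2 ^ N)..2 ^ N}}"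
  proof
    fix k :: "int ^ 'n"
    assume "k \<in> hyperbolic_cross T R"
    then obtain j where j: "j \<in> hc_levels T R" and k: "\<And>i. k $ i \<in> dyadic_block (j $ i)"
      by (auto simp: hyperbolic_cross_def)
    define m where "m = Max (range (\<lambda>i. j $ i))"
    have "m \<in> range (\<lambda>i. j $ i)"
      unfolding m_def by (intro Max_in) auto
    then obtain s where "m = j $ s"
      by auto
    then have "real m \<le> real (\<Sum>i\<in>UNIV. j $ i)"
      by (auto intro!: member_le_sum simp del: of_nat_sum)
    with j have "(1 - T) * real m \<le> (1 - T) * R + real CARD('n) - 1"
      by (simp add: hc_levels_def m_def algebra_simps)
    also have "\<dots> = (1 - T) * (R + (real CARD('n) - 1) / (1 - T))"
      using assms by (simp add: field_simps)
    also have "\<dots> \<le> (1 - T) * real N"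
      using assms N by (intro mult_left_mono) auto
    finally have "m \<le> N"
      using assms by simp
    have "k $ i \<in> {- (2 ^ N)..2 ^ N}" for i
    proof -
      have "j $ i \<le> m"
        unfolding m_def by (intro Max_ge) auto
      then have "(2::int) ^ (j $ i) \<le> 2 ^ N" "(1::int) \<le> 2 ^ (j $ i)" "(0::int) < 2 ^ (j $ i - 1)"
        using \<open>m \<le> N\<close> by (auto intro: power_increasing simp del: power_increasing_iff)
      moreover have "\<bar>k $ i\<bar> \<le> 2 ^ (j $ i)"
      proof (cases "j $ i = 0")
        case False
        then have "k $ i \<in> {- (2 ^ (j $ i))..- (2 ^ (j $ i - 1)) - 1} \<or> k $ i \<in> {2 ^ (j $ i - 1) + 1..2 ^ (j $ i)}"
          using k[of i] by (simp add: dyadic_block_def)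
        then show ?thesis
          using calculation(2,3) unfolding atLeastAtMost_iff by linarith
      qed (use k[of i] in \<open>auto simp: dyadic_block_def\<close>)
      ultimately have "\<bar>k $ i\<bar> \<le> 2 ^ N"
        by linarith
      then show ?thesis
        by (auto simp: abs_le_iff)
    qed
    then show "k \<in> {k. \<forall>i. k $ i \<in> {- (2 ^ N)..2 ^ N}}"
      by simp
  qed
  then show ?thesis
    by (rule finite_subset) (intro finite_vec_box, simp)
qed

text \<open>With y = a * ln 2 / R, the inequality exp y \<ge> 1 + y bounds the reciprocal by 1 + 1 /
  y, which grows linearly in R. For \<beta> = 0 this is the price of each non-dominant
  coordinate.\<close>

lemma inverse_one_minus_two_powr_le:
  fixes a R :: real
  assumes "a > 0" "R \<ge> 1"
  shows "1 / (1 - 2 powr (- (a / R))) \<le> (1 + 1 / (a * ln 2)) * R"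
proof -
  define y where "y = a / R * ln 2"
  have y: "y > 0"
    using assms by (simp add: y_def)
  have "2 powr (- (a / R)) = 1 / exp y"
    by (simp add: y_def powr_def exp_minus field_simps)
  also have "\<dots> \<le> 1 / (1 + y)"
    using y exp_ge_add_one_self[of y] by (intro divide_left_mono) auto
  finally have "y / (1 + y) \<le> 1 - 2 powr (- (a / R))"
    using y by (simp add: field_simps)
  then have "1 / (1 - 2 powr (- (a / R))) \<le> 1 / (y / (1 + y))"
    using y assms by (intro divide_left_mono) (auto intro!: mult_pos_pos divide_pos_pos powr_less_one)
  also have "\<dots> = 1 + 1 / (a * ln 2) * R"
    using y assms by (simp add: y_def field_simps)
  also have "\<dots> \<le> (1 + 1 / (a * ln 2)) * R"
    using assms by (simp add: algebra_simps)
  finally show ?thesis .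
qed

section \<open>Tail of the reciprocal weights outside the cross\<close>

text \<open>The frequencies are sorted by a coordinate of largest level. Outside the cross that
  level is at least R - r / (1 - T), where r is the sum of the other levels, and
  \<open>sum_level_vectors_le\<close> applies to each class. K is chosen before R and F, so the
  bound is uniform over finite sets.\<close>

lemma sum_outside_hyperbolic_cross_le:
  fixes \<alpha> \<beta> T :: real
  assumes "\<alpha> > 1 / 2" "\<beta> \<le> 0" "\<alpha> + \<beta> > 1 / 2" and T: "T = - \<beta> / \<alpha>"
  obtains K where "K > 0"
    and "\<And>R F. R \<ge> 1 \<Longrightarrow> finite F \<Longrightarrow> F \<inter> hyperbolic_cross T R = {} \<Longrightarrow>
      (\<Sum>k\<in>F. 1 / hybrid_weight \<alpha> \<beta> (k :: int ^ 'n::finite))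
        \<le> K * (2 powr (- (2 * (\<alpha> + \<beta>) - 1) * R) * (if \<beta> = 0 then R ^ (CARD('n) - 1) else 1))"
proof -
  define a b where "a = 2 * (\<alpha> + \<beta>) - 1" and "b = 2 * \<alpha> - 1"
  have ab: "a > 0" "b > 0" "a + 1 = 2 * (\<alpha> + \<beta>)" "b + 1 = 2 * \<alpha>"
    using assms by (auto simp: a_def b_def)
  have T01: "0 \<le> T" "T < 1"
    using assms by (auto simp: T field_simps)
  \<comment> \<open>The choice of T enters here: \<alpha> + \<beta> = \<alpha> * (1 - T), so the
    decay rate of the dominant level matches the slope of the threshold.\<close>
  have aT: "a + 1 = (b + 1) * (1 - T)"
  proof -
    have "\<alpha> * T = - \<beta>"
      using assms by (simp add: T)
    then show ?thesis
      unfolding ab by (simp add: algebra_simps)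
  qed
  \<comment> \<open>For \<beta> = 0 the rates a and b agree and no decay in r is left as long as r
    \<le> R; a rate of a / R is borrowed at the cost of the factor \<open>E\<close>. For \<beta> < 0
    a positive rate independent of R remains.\<close>
  define \<delta> where "\<delta> R = (if \<beta> = 0 then a / R else b - a / (1 - T))" for R
  define E where "E = (if \<beta> = 0 then 2 powr a else 1)"
  \<comment> \<open>The truncation at 0 supplies the decay for r > R when \<beta> = 0, where R - r
    alone would just cancel the gain from the other levels.\<close>
  define x where "x R r = max 0 (R - real r / (1 - T))" for R and r :: nat
  \<comment> \<open>For \<beta> < 0 the value of \<open>\<delta>\<close> does not depend on its
    argument, so \<open>\<delta> 1\<close> represents it.\<close>
  define D where "D = (if \<beta> = 0 then 3 * (1 + 1 / (a * ln 2)) else 3 / (1 - 2 powr (- \<delta> 1)))"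
  have \<delta>_pos: "\<delta> R > 0" if "R \<ge> 1" for R
  proof (cases "\<beta> = 0")
    case False
    then have "\<beta> < 0" "\<alpha> > 0"
      using assms by auto
    then have "T > 0"
      by (simp add: T divide_neg_pos)
    \<comment> \<open>As a = b * (1 - T) - T, positivity of \<open>\<delta>\<close> for \<beta> < 0
      is the positivity of T.\<close>
    have "a = (b + 1) * (1 - T) - 1"
      using aT by simp
    also have "\<dots> < b * (1 - T)"
      using \<open>T > 0\<close> by (simp add: algebra_simps)
    finally show ?thesis
      using T01 False by (simp add: \<delta>_def field_simps)
  qed (use that ab in \<open>simp add: \<delta>_def\<close>)
  have D_pos: "D > 0"
    using ab \<delta>_pos[of 1] by (auto simp: D_def powr_less_one intro!: add_pos_nonneg)
  have D: "3 / (1 - 2 powr (- \<delta> R)) \<le> D * (if \<beta> = 0 then R else 1)" if "R \<ge> 1" for R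
  proof (cases "\<beta> = 0")
    case True
    have "3 * (1 / (1 - 2 powr (- (a / R)))) \<le> 3 * ((1 + 1 / (a * ln 2)) * R)"
      using inverse_one_minus_two_powr_le[OF ab(1) that] by (rule mult_left_mono) simp
    then show ?thesis
      by (simp only: True \<delta>_def D_def if_True simp_thms mult.assoc times_divide_eq_right mult_1_right)
  qed (simp add: \<delta>_def D_def)
  have thr: "2 powr (- b * real r) * 2 powr (- a * x R r) \<le> E * 2 powr (- a * R) * 2 powr (- \<delta> R * real r)"
    if R: "R \<ge> 1" for R r
  proof (cases "\<beta> = 0")
    case True
    then have [simp]: "T = 0" "b = a"
      by (auto simp: T a_def b_def)
    \<comment> \<open>After multiplication by a, the summand 1 on the right becomes the factor
      \<open>E\<close> = 2 powr a.\<close>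
    have "R + real r / R \<le> real r + x R r + 1"
    proof (cases "real r \<le> R")
      case True
      then have "real r / R \<le> 1"
        using R by simp
      then show ?thesis
        by (simp add: x_def)
    next
      case False
      then have "0 \<le> (real r - R) * (R - 1) / R"
        using R by (intro divide_nonneg_nonneg mult_nonneg_nonneg) auto
      also have "\<dots> = real r + 1 - (R + real r / R)"
        using R by (simp add: field_simps)
      finally show ?thesis
        by (simp add: x_def)
    qed
    then have "a * (R + real r / R) \<le> a * (real r + x R r + 1)"
      using ab by (intro mult_left_mono) auto
    then show ?thesis
      by (simp add: E_def \<delta>_def True algebra_simps flip: powr_add)
  next
    case False
    have "a * (R - real r / (1 - T)) \<le> a * x R r"
      using ab by (intro mult_left_mono) (auto simp: x_def)
    then show ?thesis
      by (simp add: E_def \<delta>_def False algebra_simps flip: powr_add)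
  qed
  define K where "K = (1 + real CARD('n)) powr (- \<beta>) * 2 powr (2 * \<alpha> * real CARD('n))"
  define K' where "K' = real CARD('n) * (K * (3 / (1 - 2 powr (- a)) * E * D ^ (CARD('n) - 1)))"
  have K_pos: "K > 0"
    by (simp add: K_def)
  have C_pos: "3 / (1 - 2 powr (- a)) > 0" "E > 0"
    using ab by (auto simp: powr_less_one E_def)
  show ?thesis
  proof
    show "K' > 0"
      unfolding K'_def by (intro mult_pos_pos K_pos C_pos zero_less_power D_pos) auto
  next
    fix R :: real and F :: "(int ^ 'n) set"
    assume R: "R \<ge> 1" and F: "finite F" "F \<inter> hyperbolic_cross T R = {}"
    \<comment> \<open>All entries of vectors in F; F lies in the finite box over this set.\<close>
    define A where "A = (\<Union>k\<in>F. range (\<lambda>i. k $ i))"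
    have A: "finite A" "\<And>k i. k \<in> F \<Longrightarrow> k $ i \<in> A"
      using F by (auto simp: A_def)
    define \<rho> where "\<rho> s k = (\<Sum>i\<in>- {s}. dyadic_level (k $ i))" for s and k :: "int ^ 'n"
    have "\<exists>s. \<forall>i. dyadic_level (k $ i) \<le> dyadic_level (k $ s)" for k :: "int ^ 'n"
    proof -
      have "Max (range (\<lambda>i. dyadic_level (k $ i))) \<in> range (\<lambda>i. dyadic_level (k $ i))"
        by (intro Max_in) auto
      then obtain s where s: "Max (range (\<lambda>i. dyadic_level (k $ i))) = dyadic_level (k $ s)"
        by blast
      show ?thesis
        by (intro exI[of _ s] allI) (auto simp flip: s)
    qed
    then obtain \<sigma> where \<sigma>: "\<And>(k :: int ^ 'n) i. dyadic_level (k $ i) \<le> dyadic_level (k $ \<sigma> k)"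
      by metis
    define B where "B s = {k \<in> F. \<sigma> k = s}" for s
    have B: "x R (\<rho> s k) \<le> real (dyadic_level (k $ s))" if "k \<in> B s" for k s
    proof -
      have max: "Max (range (\<lambda>i. dyadic_level (k $ i))) = dyadic_level (k $ s)"
        using that \<sigma>[of k] by (intro Max_eqI) (auto simp: B_def)
      have "k \<notin> hyperbolic_cross T R"
        using that F by (auto simp: B_def)
      \<comment> \<open>The level vector violates the inequality defining \<open>hc_levels\<close>;
        moving the dominant level to one side and dividing by 1 - T yields the threshold.\<close>
      then have "(1 - T) * R + real CARD('n) - 1
          < real (\<Sum>i\<in>UNIV. dyadic_level (k $ i)) - T * real (dyadic_level (k $ s))"
        using level_vector_notin_hc_levels[of k T R] by (simp add: hc_levels_def max)
      also have "(\<Sum>i\<in>UNIV. dyadic_level (k $ i)) = dyadic_level (k $ s) + \<rho> s k"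
        unfolding \<rho>_def by (subst sum.remove[of _ s]) (auto simp: Compl_eq_Diff_UNIV)
      finally have "(1 - T) * R + (real CARD('n) - 1)
          < (1 - T) * real (dyadic_level (k $ s)) + real (\<rho> s k)"
        by (simp add: algebra_simps)
      moreover have "real CARD('n) \<ge> 1"
        using zero_less_card_finite[where 'a = 'n] by linarith
      ultimately have "(1 - T) * R < (1 - T) * real (dyadic_level (k $ s)) + real (\<rho> s k)"
        by linarith
      then have "R - real (\<rho> s k) / (1 - T) \<le> real (dyadic_level (k $ s))"
        using T01 by (simp add: field_simps)
      then show ?thesis
        by (simp add: x_def)
    qed
    have "(\<Sum>k\<in>B s. 1 / hybrid_weight \<alpha> \<beta> k)
        \<le> K * (3 / (1 - 2 powr (- a)) * E * D ^ (CARD('n) - 1)) *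
          (2 powr (- a * R) * (if \<beta> = 0 then R ^ (CARD('n) - 1) else 1))" for s
    proof -
      have "(\<Sum>k\<in>B s. 1 / hybrid_weight \<alpha> \<beta> k)
          \<le> (\<Sum>k\<in>B s. K * 2 powr (- (a + 1) * real (dyadic_level (k $ s)) - (b + 1) * real (\<rho> s k)))"
        unfolding ab K_def \<rho>_def using assms \<sigma>
        by (intro sum_mono inverse_hybrid_weight_le) (auto simp: B_def)
      \<comment> \<open>\<open>B s\<close> is enlarged to all vectors of the box that obey the
        threshold, the kind of set that \<open>sum_level_vectors_le\<close> handles.\<close>
      also have "\<dots> \<le> (\<Sum>k\<in>{k. (\<forall>i. k $ i \<in> A) \<and> x R (\<rho> s k) \<le> real (dyadic_level (k $ s))}.
            K * 2 powr (- (a + 1) * real (dyadic_level (k $ s)) - (b + 1) * real (\<rho> s k)))"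
      proof (rule sum_mono2)
        show "finite {k. (\<forall>i. k $ i \<in> A) \<and> x R (\<rho> s k) \<le> real (dyadic_level (k $ s))}"
          using finite_vec_box[OF A(1)] by (rule rev_finite_subset) auto
        show "B s \<subseteq> {k. (\<forall>i. k $ i \<in> A) \<and> x R (\<rho> s k) \<le> real (dyadic_level (k $ s))}"
          using A B by (auto simp: B_def)
      qed (use K_pos in auto)
      also have "\<dots> = K * (\<Sum>k\<in>{k. (\<forall>i. k $ i \<in> A) \<and> x R (\<rho> s k) \<le> real (dyadic_level (k $ s))}.
            2 powr (- (a + 1) * real (dyadic_level (k $ s)) - (b + 1) * real (\<rho> s k)))"
        by (simp add: sum_distrib_left)
      also have "\<dots> \<le> K * (3 / (1 - 2 powr (- a)) * (E * 2 powr (- a * R)) *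
            (3 / (1 - 2 powr (- \<delta> R))) ^ (CARD('n) - 1))"
        unfolding \<rho>_def using K_pos A(1) ab(1) \<delta>_pos[OF R] thr[OF R]
        by (intro mult_left_mono sum_level_vectors_le) auto
      also have "\<dots> \<le> K * (3 / (1 - 2 powr (- a)) * (E * 2 powr (- a * R)) *
            (D * (if \<beta> = 0 then R else 1)) ^ (CARD('n) - 1))"
        using K_pos C_pos D[OF R] \<delta>_pos[OF R]
        by (intro mult_left_mono power_mono mult_nonneg_nonneg)
           (auto simp: powr_less_one intro!: less_imp_le)
      also have "\<dots> = K * (3 / (1 - 2 powr (- a)) * E * D ^ (CARD('n) - 1)) *
            (2 powr (- a * R) * (if \<beta> = 0 then R ^ (CARD('n) - 1) else 1))"
        by (simp add: power_mult_distrib)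
      finally show ?thesis .
    qed
    then have "(\<Sum>s\<in>UNIV. \<Sum>k\<in>B s. 1 / hybrid_weight \<alpha> \<beta> k)
        \<le> (\<Sum>s\<in>(UNIV :: 'n set). K * (3 / (1 - 2 powr (- a)) * E * D ^ (CARD('n) - 1)) *
          (2 powr (- a * R) * (if \<beta> = 0 then R ^ (CARD('n) - 1) else 1)))"
      by (intro sum_mono)
    also have "\<dots> = K' * (2 powr (- a * R) * (if \<beta> = 0 then R ^ (CARD('n) - 1) else 1))"
      by (simp add: K'_def)
    finally have "(\<Sum>s\<in>UNIV. \<Sum>k\<in>B s. 1 / hybrid_weight \<alpha> \<beta> k)
      \<le> K' * (2 powr (- a * R) * (if \<beta> = 0 then R ^ (CARD('n) - 1) else 1))" .
    moreover have "(\<Sum>s\<in>UNIV. \<Sum>k\<in>B s. 1 / hybrid_weight \<alpha> \<beta> k) = (\<Sum>k\<in>F. 1 / hybrid_weight \<alpha> \<beta> k)"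
      unfolding B_def using F by (intro sum.group) auto
    ultimately show "(\<Sum>k\<in>F. 1 / hybrid_weight \<alpha> \<beta> k)
        \<le> K' * (2 powr (- (2 * (\<alpha> + \<beta>) - 1) * R) * (if \<beta> = 0 then R ^ (CARD('n) - 1) else 1))"
      by (simp add: a_def)
  qed
qed

section \<open>Fourier series on the torus\<close>

lemma of_int_vec_nth [simp]: "of_int_vec k $ i = of_int (k $ i)"
  by (simp add: of_int_vec_def)

lemma torus_char_prod: "torus_char k x = (\<Prod>i\<in>UNIV. cis (2 * pi * (of_int (k $ i) * x $ i)))"
  by (simp add: torus_char_def inner_vec_def sum_distrib_left cis_conv_exp exp_sum of_real_sum)

lemma norm_torus_char [simp]: "norm (torus_char k x) = 1"
  by (simp add: torus_char_def)

lemma torus_char_0 [simp]: "torus_char 0 x = 1" "torus_char k 0 = 1"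
  by (simp_all add: torus_char_prod)

lemma torus_char_add: "torus_char (k + l) x = torus_char k x * torus_char l x"
  by (simp add: torus_char_prod cis_mult algebra_simps flip: prod.distrib)

lemma cnj_torus_char: "cnj (torus_char k x) = torus_char (- k) x"
  by (simp add: torus_char_prod cis_cnj)

lemma torus_char_of_int_vec: "torus_char k (of_int_vec m) = 1"
proof -
  have "cis (2 * pi * (of_int (k $ i) * of_int (m $ i))) = 1" for i
    using cis_multiple_2pi[of "of_int (k $ i * m $ i)"] by simp
  then show ?thesis
    by (simp add: torus_char_prod)
qed

lemma torus_char_shift: "torus_char k (x + y) = torus_char k x * torus_char k y"
  by (simp add: torus_char_prod cis_mult algebra_simps flip: prod.distrib)

lemma continuous_on_torus_char [continuous_intros]: "continuous_on S (torus_char k)"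
  unfolding torus_char_def by (intro continuous_intros)

lemma unit_cube_measurable: "{x :: real ^ 'n::finite. \<forall>i. 0 \<le> x $ i \<and> x $ i < 1} \<in> sets borel"
proof -
  have "{x :: real ^ 'n. \<forall>i. 0 \<le> x $ i \<and> x $ i < 1} = (\<Inter>i. {x. 0 \<le> x $ i} \<inter> {x. x $ i < 1})"
    by auto
  also have "\<dots> \<in> sets borel"
    by (intro sets.countable_INT'' sets.Int borel_closed borel_open
          closed_Collect_le open_Collect_less continuous_intros) auto
  finally show ?thesis .
qed

lemma unit_cube_subset_cbox: "{x :: real ^ 'n::finite. \<forall>i. 0 \<le> x $ i \<and> x $ i < 1} \<subseteq> cbox 0 1"
  by (auto simp: mem_box_cart less_imp_le)

lemma finite_measure_torus: "finite_measure (torus_measure :: (real ^ 'n::finite) measure)"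
proof
  have "emeasure (torus_measure :: (real ^ 'n) measure) (space torus_measure)
      = emeasure lebesgue {x :: real ^ 'n. \<forall>i. 0 \<le> x $ i \<and> x $ i < 1}"
    using unit_cube_measurable by (simp add: torus_measure_def emeasure_restrict_space)
  also have "\<dots> \<le> emeasure lebesgue (cbox 0 1 :: (real ^ 'n) set)"
    by (intro emeasure_mono unit_cube_subset_cbox) auto
  also have "\<dots> < \<infinity>"
    using emeasure_lborel_cbox_finite[of 0 "1 :: real ^ 'n"] by simp
  finally show "emeasure (torus_measure :: (real ^ 'n) measure) (space torus_measure) \<noteq> \<infinity>"
    by simp
qed

lemma continuous_imp_measurable_torus:
  assumes "continuous_on UNIV f"
  shows "f \<in> borel_measurable torus_measure"
  unfolding torus_measure_def
  using assms unit_cube_measurable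
  by (intro continuous_imp_measurable_on_sets_lebesgue) (auto intro: continuous_on_subset)

lemma continuous_imp_integrable_torus:
  fixes f :: "real ^ 'n::finite \<Rightarrow> 'b::{banach, second_countable_topology}"
  assumes "continuous_on UNIV f"
  shows "integrable torus_measure f"
proof -
  interpret finite_measure "torus_measure :: (real ^ 'n) measure"
    by (rule finite_measure_torus)
  have "compact (f ` cbox 0 1)"
    using assms by (intro compact_continuous_image) (auto intro: continuous_on_subset)
  then obtain C where C: "\<And>x. x \<in> cbox 0 1 \<Longrightarrow> norm (f x) \<le> C"
    by (meson bounded_iff compact_imp_bounded imageI)
  show ?thesis
  proof (rule integrable_const_bound)
    show "AE x in torus_measure. norm (f x) \<le> C"
      using unit_cube_subset_cbox by (intro AE_I2) (auto simp: torus_measure_def intro!: C)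
    show "f \<in> borel_measurable torus_measure"
      using assms by (rule continuous_imp_measurable_torus)
  qed
qed

text \<open>Fubini for a product of one-variable functions. The product measure behind
  \<open>lborel\<close> is indexed by the standard basis, so the bijection \<open>e\<close> from
  coordinates to basis vectors carries the reindexing.\<close>

lemma integral_lborel_prod_vec:
  fixes \<phi> :: "'n::finite \<Rightarrow> real \<Rightarrow> complex"
  assumes "\<And>i. integrable lborel (\<phi> i)"
  shows "(LINT x|lborel. (\<Prod>i\<in>UNIV. \<phi> i (x $ i))) = (\<Prod>i\<in>UNIV. (LINT t|lborel. \<phi> i t))"
proof -
  interpret product_sigma_finite "\<lambda>_ :: real ^ 'n. lborel :: real measure" ..
  define e where "e i = (axis i 1 :: real ^ 'n)" for i
  have e: "bij_betw e UNIV Basis"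
    by (auto simp: bij_betw_def inj_on_def e_def axis_eq_axis Basis_vec_def)
  have inv_e: "inv e (e i) = i" for i
    using e by (simp add: bij_betw_def)
  have nth: "(\<Sum>b\<in>Basis. f b *\<^sub>R b) $ i = f (e i)" for f :: "real ^ 'n \<Rightarrow> real" and i
  proof -
    have "(\<Sum>b\<in>Basis. f b *\<^sub>R b) $ i = (\<Sum>b\<in>Basis. f b *\<^sub>R b) \<bullet> e i"
      by (simp add: e_def inner_axis)
    also have "\<dots> = f (e i)"
      using e by (intro inner_sum_left_Basis) (auto simp: bij_betw_def)
    finally show ?thesis .
  qed
  have [measurable]: "\<phi> i \<in> borel_measurable borel" for i
    using assms[of i] by (simp add: integrable_iff_bounded)
  have "(\<lambda>x :: real ^ 'n. \<Prod>i\<in>UNIV. \<phi> i (x $ i)) \<in> borel_measurable borel"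
    by measurable
  then have "(LINT x|lborel. (\<Prod>i\<in>UNIV. \<phi> i (x $ i)))
      = (LINT f|(\<Pi>\<^sub>M b\<in>Basis. lborel). (\<Prod>i\<in>UNIV. \<phi> i (f (e i))))"
    unfolding lborel_eq[where 'a = "real ^ 'n"] by (subst integral_distr) (simp_all only: nth, measurable)
  also have "\<dots> = (LINT f|(\<Pi>\<^sub>M b\<in>Basis. lborel). (\<Prod>b\<in>Basis. \<phi> (inv e b) (f b)))"
    by (intro Bochner_Integration.integral_cong refl)
       (simp add: prod.reindex_bij_betw[OF e, symmetric] inv_e)
  also have "\<dots> = (\<Prod>b\<in>Basis. (LINT t|lborel. \<phi> (inv e b) t))"
    by (rule product_integral_prod) (auto simp: assms)
  also have "\<dots> = (\<Prod>i\<in>UNIV. (LINT t|lborel. \<phi> i t))"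
    by (simp add: prod.reindex_bij_betw[OF e, symmetric] inv_e)
  finally show ?thesis .
qed

lemma integral_cis_unit_interval:
  fixes n :: int
  defines "f \<equiv> \<lambda>t. indicator {0..<1::real} t *\<^sub>R cis (2 * pi * (of_int n * t))"
  shows "integrable lborel f" "(LINT t|lborel. f t) = (if n = 0 then 1 else 0)"
proof -
  \<comment> \<open>The closed interval allows the fundamental theorem of calculus; it differs from
    the half-open one by a null set.\<close>
  define g where "g t = indicator {0..1::real} t *\<^sub>R cis (2 * pi * (of_int n * t))" for t
  have "continuous_on {0..1} (\<lambda>t. cis (2 * pi * (of_int n * t)))"
    by (intro continuous_intros)
  then have g_int: "integrable lborel g"
    unfolding g_def by (intro borel_integrable_compact) auto
  have [measurable]: "(\<lambda>t. cis (2 * pi * (of_int n * t))) \<in> borel_measurable borel"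
    by (intro borel_measurable_continuous_onI continuous_intros)
  have [measurable]: "f \<in> borel_measurable lborel"
    unfolding f_def by measurable
  have ae: "AE t in lborel. g t = f t"
    using AE_lborel_singleton[of 1] by eventually_elim (auto simp: f_def g_def indicator_def)
  show "integrable lborel f"
    by (rule integrable_cong_AE_imp[OF g_int _ ae]) measurable
  have "(LINT t|lborel. f t) = (LINT t|lborel. g t)"
    using ae g_int by (intro integral_cong_AE) (auto elim: AE_mp)
  also have "\<dots> = (if n = 0 then 1 else 0)"
  proof (cases "n = 0")
    case True
    then show ?thesis
      by (simp add: g_def)
  next
    case False
    define F where "F t = cis (2 * pi * (of_int n * t)) / (2 * pi * \<i> * of_int n)" for t :: real
    have "(F has_vector_derivative cis (2 * pi * (of_int n * t))) (at t within {0..1})" for t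
      unfolding F_def cis_conv_exp using False
      by (auto intro!: derivative_eq_intros has_vector_derivative_real_field simp: field_simps)
    then have "(LINT t|lborel. g t) = F 1 - F 0"
      unfolding g_def by (intro integral_FTC_Icc continuous_intros) auto
    also have "F 1 = F 0"
      using cis_multiple_2pi[of "of_int n"] by (simp add: F_def)
    finally show ?thesis
      using False by simp
  qed
  finally show "(LINT t|lborel. f t) = (if n = 0 then 1 else 0)" .
qed

text \<open>Passing from Lebesgue to Borel measure lets the integral factor into one-dimensional
  integrals, each of which vanishes unless its frequency is 0.\<close>

lemma integral_torus_char:
  "(LINT x|torus_measure. torus_char k x) = (if k = 0 then 1 else 0)"
proof -
  let ?Q = "{x :: real ^ 'a. \<forall>i. 0 \<le> x $ i \<and> x $ i < 1}"
  have "(LINT x|torus_measure. torus_char k x) = (LINT x|lebesgue. indicator ?Q x *\<^sub>R torus_char k x)"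
    unfolding torus_measure_def using unit_cube_measurable by (intro integral_restrict_space) auto
  also have "\<dots> = (LINT x|lborel. indicator ?Q x *\<^sub>R torus_char k x)"
    using unit_cube_measurable
    by (intro integral_completion borel_measurable_scaleR borel_measurable_indicator)
       (auto intro!: borel_measurable_continuous_onI continuous_intros)
  also have "\<dots> = (LINT x|lborel. (\<Prod>i\<in>UNIV.
      indicator {0..<1::real} (x $ i) *\<^sub>R cis (2 * pi * (of_int (k $ i) * x $ i))))"
  proof (intro Bochner_Integration.integral_cong refl)
    fix x :: "real ^ 'a"
    have "indicator ?Q x = (\<Prod>i\<in>UNIV. indicator {0..<1::real} (x $ i) :: real)"
      by (auto simp: indicator_def)
    then show "indicator ?Q x *\<^sub>R torus_char k x
        = (\<Prod>i\<in>UNIV. indicator {0..<1::real} (x $ i) *\<^sub>R cis (2 * pi * (of_int (k $ i) * x $ i)))"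
      by (simp add: torus_char_prod scaleR_conv_of_real prod.distrib)
  qed
  also have "\<dots> = (\<Prod>i\<in>UNIV. if k $ i = 0 then 1 else 0)"
    by (subst integral_lborel_prod_vec) (simp_all add: integral_cis_unit_interval)
  also have "\<dots> = (if k = 0 then 1 else 0)"
    by (auto simp: vec_eq_iff)
  finally show ?thesis .
qed

lemma fourier_coeff_torus_char: "fourier_coeff (torus_char l) k = (if l = k then 1 else 0)"
  by (simp add: fourier_coeff_def cnj_torus_char integral_torus_char flip: torus_char_add)

lemma measure_torus: "measure torus_measure (space (torus_measure :: (real ^ 'n::finite) measure)) = 1"
  using integral_torus_char[of "0 :: int ^ 'n"] by (simp add: scaleR_conv_of_real)

section \<open>Uniform density of trigonometric polynomials\<close>

text \<open>Generated by monomials and sums, so that linear statements follow by induction. Closure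
  under products, proved below, makes this the algebra for Stone-Weierstrass.\<close>

inductive_set trig_polys :: "(real ^ 'n::finite \<Rightarrow> complex) set" where
  monomial: "(\<lambda>x. c * torus_char k x) \<in> trig_polys"
| add: "p \<in> trig_polys \<Longrightarrow> q \<in> trig_polys \<Longrightarrow> (\<lambda>x. p x + q x) \<in> trig_polys"

lemma trig_polys_const: "(\<lambda>x. c) \<in> trig_polys"
  using trig_polys.monomial[of c 0] by simp

lemma trig_polys_monomial_mult:
  assumes "q \<in> trig_polys"
  shows "(\<lambda>x. c * torus_char k x * q x) \<in> trig_polys"
  using assms
proof induction
  case (monomial c' k')
  show ?case
    using trig_polys.monomial[of "c * c'" "k + k'"] by (simp add: torus_char_add mult_ac)
qed (auto simp: distrib_left intro: trig_polys.add)

lemma trig_polys_mult: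
  assumes "p \<in> trig_polys" "q \<in> trig_polys"
  shows "(\<lambda>x. p x * q x) \<in> trig_polys"
  using assms
  by induction (auto simp: distrib_right intro: trig_polys.add trig_polys_monomial_mult)

lemma continuous_on_trig_polys: "p \<in> trig_polys \<Longrightarrow> continuous_on UNIV p"
  by (induction rule: trig_polys.induct) (auto intro!: continuous_intros)

text \<open>Euler's formulas. These functions are the real and imaginary parts of the coordinates of
  \<open>torus_embed\<close>, which separate points.\<close>

lemma trig_polys_coordinate:
  "(\<lambda>x. complex_of_real (cos (2 * pi * x $ i))) \<in> trig_polys"
  "(\<lambda>x. complex_of_real (sin (2 * pi * x $ i))) \<in> trig_polys"
proof -
  have char: "torus_char (axis i n) x = cis (2 * pi * (of_int n * x $ i))" for n x
  proof -
    have "of_int_vec (axis i n) = axis i (of_int n)"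
      by (simp add: vec_eq_iff axis_def)
    then show ?thesis
      by (simp add: torus_char_def inner_axis')
  qed
  show "(\<lambda>x. complex_of_real (cos (2 * pi * x $ i))) \<in> trig_polys"
    using trig_polys.add[OF trig_polys.monomial[of "1/2" "axis i 1"] trig_polys.monomial[of "1/2" "axis i (-1)"]]
    by (rule back_subst[of "\<lambda>p. p \<in> trig_polys"]) (auto simp: char fun_eq_iff complex_eq_iff)
  show "(\<lambda>x. complex_of_real (sin (2 * pi * x $ i))) \<in> trig_polys"
    using trig_polys.add[OF trig_polys.monomial[of "-\<i>/2" "axis i 1"] trig_polys.monomial[of "\<i>/2" "axis i (-1)"]]
    by (rule back_subst[of "\<lambda>p. p \<in> trig_polys"]) (auto simp: char fun_eq_iff complex_eq_iff)
qed

text \<open>Realizes the torus as a product of circles, a compact set on which Stone-Weierstrass is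
  available; periodic functions are those that factor through this map.\<close>

definition torus_embed :: "real ^ 'n::finite \<Rightarrow> complex ^ 'n" where
  "torus_embed x = (\<chi> i. cis (2 * pi * x $ i))"

lemma torus_embed_eqD:
  assumes "torus_embed x = torus_embed y"
  obtains m where "x = y + of_int_vec m"
proof -
  have "\<exists>n :: int. x $ i = y $ i + of_int n" for i
  proof -
    have "cis (2 * pi * x $ i) = cis (2 * pi * y $ i)"
      using assms by (simp add: torus_embed_def vec_eq_iff)
    then have "sin (2 * pi * x $ i) = sin (2 * pi * y $ i) \<and> cos (2 * pi * x $ i) = cos (2 * pi * y $ i)"
      by (simp add: complex_eq_iff)
    then obtain n :: int where "2 * pi * x $ i = 2 * pi * y $ i + 2 * pi * of_int n"
      unfolding sin_cos_eq_iff by blast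
    then have "2 * pi * x $ i = 2 * pi * (y $ i + of_int n)"
      by (simp add: algebra_simps)
    then show ?thesis
      by auto
  qed
  then obtain m where "\<And>i. x $ i = y $ i + of_int (m i)"
    by metis
  then have "x = y + of_int_vec (\<chi> i. m i)"
    by (simp add: vec_eq_iff)
  then show ?thesis ..
qed

lemma unit_cube_representative:
  obtains y m where "x = y + of_int_vec m" "y \<in> cbox (0 :: real ^ 'n::finite) 1"
proof
  show "x = (\<chi> i. frac (x $ i)) + of_int_vec (\<chi> i. \<lfloor>x $ i\<rfloor>)"
    by (simp add: vec_eq_iff frac_def)
  show "(\<chi> i. frac (x $ i)) \<in> cbox 0 1"
    by (auto simp: mem_box_cart frac_ge_0 less_imp_le frac_lt_1)
qed

lemma torus_embed_shift: "torus_embed (x + of_int_vec m) = torus_embed x"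
proof -
  have "cis (2 * pi * of_int (m $ i)) = 1" for i
    using cis_multiple_2pi[of "of_int (m $ i)"] by simp
  then have "cis (2 * pi * (x $ i + of_int (m $ i))) = cis (2 * pi * x $ i)" for i
    by (simp add: distrib_left flip: cis_mult)
  then show ?thesis
    by (simp add: torus_embed_def vec_eq_iff)
qed

text \<open>The periodic function u descends to a continuous function v on the compact image
  \<open>S\<close>. The functions on \<open>S\<close> whose pullback is a trigonometric polynomial
  form a point-separating algebra, so they approximate v uniformly.\<close>

lemma trig_polys_dense_real:
  fixes u :: "real ^ 'n::finite \<Rightarrow> real"
  assumes u: "continuous_on UNIV u" "\<And>x m. u (x + of_int_vec m) = u x" and "e > 0"
  obtains p where "p \<in> trig_polys" "\<And>x. norm (complex_of_real (u x) - p x) < e"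
proof -
  define S where "S = torus_embed ` cbox (0 :: real ^ 'n) 1"
  define P where "P g \<longleftrightarrow> continuous_on S g \<and> (\<lambda>x. complex_of_real (g (torus_embed x))) \<in> trig_polys"
    for g :: "complex ^ 'n \<Rightarrow> real"
  have cont: "continuous_on A torus_embed" for A :: "(real ^ 'n) set"
    unfolding torus_embed_def by (intro continuous_intros)
  have S: "compact S"
    unfolding S_def by (intro compact_continuous_image cont compact_cbox)
  have in_S: "torus_embed x \<in> S" for x
  proof -
    obtain y m where "x = y + of_int_vec m" "y \<in> cbox (0 :: real ^ 'n) 1"
      by (rule unit_cube_representative)
    then show ?thesis
      by (auto simp: S_def torus_embed_shift)
  qed
  \<comment> \<open>Any preimage may be chosen: two of them differ by an integer vector, under which
    u is invariant.\<close>
  define v where "v w = u (SOME x. torus_embed x = w)" for w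
  have v: "v (torus_embed x) = u x" for x
  proof -
    have "torus_embed (SOME y. torus_embed y = torus_embed x) = torus_embed x"
      by (rule someI) simp
    then obtain m where "(SOME y. torus_embed y = torus_embed x) = x + of_int_vec m"
      by (rule torus_embed_eqD)
    then show ?thesis
      by (simp add: v_def u)
  qed
  have "continuous_on S v"
    unfolding continuous_on_closed_vimage[OF compact_imp_closed[OF S]]
  proof (intro allI impI)
    fix B :: "real set" assume "closed B"
    then have "closed (u -` B)"
      using u(1) by (simp add: continuous_closed_vimage continuous_on_eq_continuous_at)
    \<comment> \<open>Continuity of \<open>v\<close> by compactness: the preimage of a closed set
      under \<open>v\<close> is the image of a compact part of the unit cube.\<close>
    then have "compact (torus_embed ` (u -` B \<inter> cbox 0 1))"
      by (intro compact_continuous_image cont closed_Int_compact compact_cbox)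
    moreover have "torus_embed ` (u -` B \<inter> cbox 0 1) = v -` B \<inter> S"
      by (auto simp: S_def v)
    ultimately show "closed (v -` B \<inter> S)"
      by (simp add: compact_imp_closed)
  qed
  have "\<exists>g. P g \<and> (\<forall>w\<in>S. \<bar>v w - g w\<bar> < e)"
  proof (rule Stone_Weierstrass_HOL[OF S _ _ _ _ _ \<open>continuous_on S v\<close> \<open>e > 0\<close>])
    fix w w' assume w: "w \<in> S \<and> w' \<in> S \<and> w \<noteq> w'"
    then obtain i where "Re (w $ i) \<noteq> Re (w' $ i) \<or> Im (w $ i) \<noteq> Im (w' $ i)"
      by (auto simp: vec_eq_iff complex_eq_iff)
    moreover have "P (\<lambda>w. Re (w $ i))" "P (\<lambda>w. Im (w $ i))"
      using trig_polys_coordinate[of i] by (auto simp: P_def torus_embed_def intro!: continuous_intros)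
    ultimately show "\<exists>g. P g \<and> g w \<noteq> g w'"
      by blast
  qed (auto simp: P_def intro: trig_polys_const trig_polys.add trig_polys_mult continuous_intros)
  then obtain g where g: "P g" "\<And>w. w \<in> S \<Longrightarrow> \<bar>v w - g w\<bar> < e"
    by blast
  show ?thesis
  proof
    show "(\<lambda>x. complex_of_real (g (torus_embed x))) \<in> trig_polys"
      using g by (simp add: P_def)
    show "norm (complex_of_real (u x) - complex_of_real (g (torus_embed x))) < e" for x
      using g(2)[OF in_S, of x] by (simp add: v flip: of_real_diff)
  qed
qed

lemma trig_polys_dense:
  fixes f :: "real ^ 'n::finite \<Rightarrow> complex"
  assumes f: "continuous_on UNIV f" "periodic f" and "e > 0"
  obtains p where "p \<in> trig_polys" "\<And>x. norm (f x - p x) < e"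
proof -
  obtain p where p: "p \<in> trig_polys" "\<And>x. norm (complex_of_real (Re (f x)) - p x) < e / 2"
    using f \<open>e > 0\<close> by (rule_tac trig_polys_dense_real[of "\<lambda>x. Re (f x)" "e / 2"])
      (auto simp: periodic_def intro!: continuous_intros)
  obtain q where q: "q \<in> trig_polys" "\<And>x. norm (complex_of_real (Im (f x)) - q x) < e / 2"
    using f \<open>e > 0\<close> by (rule_tac trig_polys_dense_real[of "\<lambda>x. Im (f x)" "e / 2"])
      (auto simp: periodic_def intro!: continuous_intros)
  show ?thesis
  proof
    show "(\<lambda>x. p x + \<i> * q x) \<in> trig_polys"
      using p q trig_polys_const by (intro trig_polys.add trig_polys_mult)
    fix x
    have "f x - (p x + \<i> * q x) = (complex_of_real (Re (f x)) - p x) + \<i> * (complex_of_real (Im (f x)) - q x)"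
      by (subst complex_eq[of "f x"]) (simp add: algebra_simps)
    also have "norm \<dots> \<le> norm (complex_of_real (Re (f x)) - p x) + norm (complex_of_real (Im (f x)) - q x)"
      by (rule order_trans[OF norm_triangle_ineq]) (simp add: norm_mult)
    also have "\<dots> < e"
      using p(2)[of x] q(2)[of x] by linarith
    finally show "norm (f x - (p x + \<i> * q x)) < e" .
  qed
qed

section \<open>Uniqueness of Fourier coefficients and inversion\<close>

text \<open>Such an f is orthogonal to every trigonometric polynomial. Approximating its conjugate
  uniformly makes the integral of the squared norm arbitrarily small, hence zero, so f vanishes
  almost everywhere and by continuity and periodicity everywhere.\<close>

lemma fourier_coeff_eq_0_imp_eq_0:
  fixes f :: "real ^ 'n::finite \<Rightarrow> complex"
  assumes f: "continuous_on UNIV f" "periodic f" and zero: "\<And>k. fourier_coeff f k = 0"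
  shows "f x = 0"
proof -
  have int: "integrable torus_measure g" if "continuous_on UNIV g" for g :: "real ^ 'n \<Rightarrow> complex"
    by (rule continuous_imp_integrable_torus) fact
  have orth: "(LINT x|torus_measure. f x * p x) = 0" if "p \<in> trig_polys" for p
    using that
  proof induction
    case (monomial c k)
    have "(LINT x|torus_measure. f x * (c * torus_char k x)) = (LINT x|torus_measure. c * (f x * torus_char k x))"
      by (simp add: mult_ac)
    also have "\<dots> = 0"
      using zero[of "- k"] by (simp add: fourier_coeff_def cnj_torus_char)
    finally show ?case .
  next
    case (add p q)
    have "integrable torus_measure (\<lambda>x. f x * p x)" "integrable torus_measure (\<lambda>x. f x * q x)"
      using add.hyps(1,2)[THEN continuous_on_trig_polys] f(1) by (auto intro!: int continuous_intros)
    then show ?case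
      using add by (simp add: distrib_left)
  qed
  define C where "C = (LINT x|torus_measure. norm (f x))"
  have le: "(LINT x|torus_measure. (norm (f x))\<^sup>2) \<le> C * e" if e: "e > 0" for e
  proof -
    obtain p where p: "p \<in> trig_polys" "\<And>x. norm (cnj (f x) - p x) < e"
      using f e by (rule_tac trig_polys_dense[of "\<lambda>x. cnj (f x)" e])
        (auto simp: periodic_def intro!: continuous_intros)
    note cp = continuous_on_trig_polys[OF p(1)]
    have "complex_of_real (LINT x|torus_measure. (norm (f x))\<^sup>2) = (LINT x|torus_measure. f x * cnj (f x))"
      by (simp only: complex_norm_square flip: integral_complex_of_real)
    also have "\<dots> = (LINT x|torus_measure. f x * cnj (f x)) - (LINT x|torus_measure. f x * p x)"
      by (simp add: orth[OF p(1)])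
    also have "\<dots> = (LINT x|torus_measure. f x * (cnj (f x) - p x))"
      unfolding right_diff_distrib using f cp
      by (intro Bochner_Integration.integral_diff[symmetric] int continuous_intros)
    finally have "norm (complex_of_real (LINT x|torus_measure. (norm (f x))\<^sup>2))
        = norm (LINT x|torus_measure. f x * (cnj (f x) - p x))"
      by simp
    also have "\<dots> \<le> (LINT x|torus_measure. norm (f x * (cnj (f x) - p x)))"
      by (rule integral_norm_bound)
    also have "\<dots> \<le> (LINT x|torus_measure. norm (f x) * e)"
      using f cp p(2)[THEN less_imp_le]
      by (intro Bochner_Integration.integral_mono continuous_imp_integrable_torus continuous_intros)
         (auto simp: norm_mult intro!: mult_left_mono)
    also have "\<dots> = C * e"
      by (simp add: C_def)
    finally show ?thesis
      by (simp add: abs_le_iff)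
  qed
  have "((\<lambda>e. C * e) \<longlongrightarrow> C * 0) (at_right 0)"
    by (intro tendsto_intros)
  then have "(LINT x|torus_measure. (norm (f x))\<^sup>2) \<le> C * 0"
    by (rule tendsto_lowerbound) (auto simp: eventually_at_filter le)
  then have "(LINT x|torus_measure. (norm (f x))\<^sup>2) = 0"
    by (intro antisym) auto
  moreover have "integrable torus_measure (\<lambda>x. (norm (f x))\<^sup>2)"
    using f by (intro continuous_imp_integrable_torus continuous_intros)
  ultimately have "AE x in torus_measure. (norm (f x))\<^sup>2 = 0"
    by (subst (asm) integral_nonneg_eq_0_iff_AE) auto
  then have "AE x in lebesgue. (\<forall>i. 0 \<le> x $ i \<and> x $ i < 1) \<longrightarrow> f x = 0"
    unfolding torus_measure_def using unit_cube_measurable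
    by (subst (asm) AE_restrict_space_iff) auto
  \<comment> \<open>The open cube is used because a closed set containing almost every point of an
    open set contains all of them; the boundary follows by taking the closure.\<close>
  then have "AE x \<in> box 0 1 in lebesgue. x \<in> f -` {0}"
    by eventually_elim (auto simp: mem_box_cart less_imp_le)
  moreover have "closed (f -` {0})"
    using f by (intro continuous_closed_vimage) (auto simp: continuous_on_eq_continuous_at)
  ultimately have "f y = 0" if "y \<in> box 0 1" for y
    using mem_closed_if_AE_lebesgue_open[of "box 0 1" "f -` {0}" y] that by auto
  moreover have "closure (box 0 1) = cbox (0 :: real ^ 'n) 1"
    by (rule closure_box) (simp add: interval_eq_empty_cart)
  ultimately have "f y = 0" if "y \<in> cbox 0 1" for y
    using continuous_constant_on_closure[of "box 0 1" f 0 y] that f(1)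
    by (auto intro: continuous_on_subset)
  moreover obtain y m where "x = y + of_int_vec m" "y \<in> cbox (0 :: real ^ 'n) 1"
    by (rule unit_cube_representative)
  ultimately show ?thesis
    using f(2) by (simp add: periodic_def)
qed

lemma fourier_coeff_diff:
  assumes "continuous_on UNIV f" "continuous_on UNIV g"
  shows "fourier_coeff (\<lambda>x. f x - g x) k = fourier_coeff f k - fourier_coeff g k"
  unfolding fourier_coeff_def left_diff_distrib using assms
  by (intro Bochner_Integration.integral_diff continuous_imp_integrable_torus continuous_intros)

lemma fourier_coeff_trig_sum:
  assumes "finite F"
  shows "fourier_coeff (\<lambda>x. \<Sum>l\<in>F. c l * torus_char l x) k = (if k \<in> F then c k else 0)"
proof -
  have "fourier_coeff (\<lambda>x. \<Sum>l\<in>F. c l * torus_char l x) k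
      = (LINT x|torus_measure. (\<Sum>l\<in>F. c l * (torus_char l x * cnj (torus_char k x))))"
    by (simp add: fourier_coeff_def sum_distrib_right mult.assoc)
  also have "\<dots> = (\<Sum>l\<in>F. (LINT x|torus_measure. c l * (torus_char l x * cnj (torus_char k x))))"
    by (intro Bochner_Integration.integral_sum continuous_imp_integrable_torus continuous_intros)
  also have "\<dots> = (\<Sum>l\<in>F. c l * fourier_coeff (torus_char l) k)"
    by (simp add: fourier_coeff_def)
  also have "\<dots> = (if k \<in> F then c k else 0)"
    using assms by (simp add: fourier_coeff_torus_char if_distrib cong: if_cong)
  finally show ?thesis .
qed

lemma norm_fourier_coeff_le:
  fixes f :: "real ^ 'n::finite \<Rightarrow> complex"
  assumes "continuous_on UNIV f" "\<And>x. norm (f x) \<le> e"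
  shows "norm (fourier_coeff f k) \<le> e"
proof -
  have "norm (fourier_coeff f k) \<le> (LINT x|torus_measure. norm (f x * cnj (torus_char k x)))"
    unfolding fourier_coeff_def by (rule integral_norm_bound)
  also have "\<dots> \<le> (LINT x|(torus_measure :: (real ^ 'n) measure). e)"
    using assms by (intro Bochner_Integration.integral_mono continuous_imp_integrable_torus continuous_intros)
      (auto simp: norm_mult)
  also have "\<dots> = e"
    by (simp add: measure_torus)
  finally show ?thesis .
qed

text \<open>Absolute summability makes the series converge uniformly to a continuous periodic g with
  the same coefficients as f, and uniqueness gives f = g.\<close>

theorem fourier_inversion:
  fixes f :: "real ^ 'n::finite \<Rightarrow> complex"
  assumes f: "continuous_on UNIV f" "periodic f"
    and summable: "(\<lambda>k. norm (fourier_coeff f k)) summable_on UNIV"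
  shows "((\<lambda>k. fourier_coeff f k * torus_char k x) has_sum f x) UNIV"
proof -
  define c where "c = fourier_coeff f"
  define g where "g x = (\<Sum>\<^sub>\<infinity>k. c k * torus_char k x)" for x
  have lim: "uniform_limit UNIV (\<lambda>F x. \<Sum>k\<in>F. c k * torus_char k x) g (finite_subsets_at_top UNIV)"
    unfolding g_def using summable
    by (intro Weierstrass_m_test_general[where M = "\<lambda>k. norm (c k)"]) (auto simp: c_def norm_mult)
  have cont: "continuous_on UNIV (\<lambda>x. \<Sum>k\<in>F. c k * torus_char k x)" for F
    by (intro continuous_intros)
  have g: "continuous_on UNIV g"
    by (rule uniform_limit_theorem[OF _ lim]) (auto intro: always_eventually cont)
  have "periodic g"
    by (simp add: periodic_def g_def torus_char_shift torus_char_of_int_vec)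
  have "fourier_coeff g k = c k" for k
  proof -
    \<comment> \<open>A partial sum over an F containing k already has k-th coefficient
      \<open>c k\<close>, and a uniform error of at most e changes coefficients by at most
      e.\<close>
    have "norm (fourier_coeff g k - c k) \<le> e" if "e > 0" for e
    proof -
      have "\<forall>\<^sub>F F in finite_subsets_at_top UNIV. (finite F \<and> k \<in> F) \<and>
          (\<forall>x\<in>UNIV. dist (\<Sum>k\<in>F. c k * torus_char k x) (g x) < e)"
        using that uniform_limitD[OF lim]
        by (intro eventually_conj) (auto simp: eventually_finite_subsets_at_top intro!: exI[of _ "{k}"])
      then obtain F where F: "finite F" "k \<in> F" "\<And>x. dist (\<Sum>k\<in>F. c k * torus_char k x) (g x) < e"
        by (auto dest!: eventually_happens)
      have "norm (fourier_coeff (\<lambda>x. g x - (\<Sum>k\<in>F. c k * torus_char k x)) k) \<le> e"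
        using F(3) by (intro norm_fourier_coeff_le continuous_intros g)
          (auto simp: dist_norm norm_minus_commute less_imp_le)
      then show ?thesis
        using F g cont by (simp add: fourier_coeff_diff fourier_coeff_trig_sum)
    qed
    then have "norm (fourier_coeff g k - c k) \<le> 0"
      by (rule field_le_epsilon) simp
    then show ?thesis
      by simp
  qed
  then have "f x - g x = 0"
    using f g \<open>periodic g\<close>
    by (intro fourier_coeff_eq_0_imp_eq_0[of "\<lambda>x. f x - g x"] continuous_intros)
       (auto simp: periodic_def fourier_coeff_diff c_def)
  moreover have "(\<lambda>k. c k * torus_char k x) summable_on UNIV"
    using summable by (rule_tac abs_summable_summable) (simp add: norm_mult c_def)
  then have "((\<lambda>k. c k * torus_char k x) has_sum g x) UNIV"
    unfolding g_def by (rule has_sum_infsum)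
  ultimately show ?thesis
    by (simp add: c_def)
qed

section \<open>Aliasing\<close>

lemma int_dot_diff: "int_dot (h - k) z = int_dot h z - int_dot k z"
  by (simp add: int_dot_def left_diff_distrib sum_subtractf)

text \<open>Along the lattice a character runs through the powers of a single root of unity, so
  lattice coefficients of characters are geometric sums.\<close>

lemma torus_char_lattice_node:
  "torus_char k (lattice_node z M j) = cis (2 * pi * (of_int (int_dot k z) / of_nat M)) ^ j"
proof -
  have "of_int_vec k \<bullet> of_int_vec z = of_int (int_dot k z)"
    by (simp add: inner_vec_def int_dot_def)
  then have "2 * pi * (of_int_vec k \<bullet> lattice_node z M j)
      = real j * (2 * pi * (of_int (int_dot k z) / of_nat M))"
    by (simp add: lattice_node_def)
  then show ?thesis
    by (simp only: torus_char_def Complex.DeMoivre)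
qed

lemma lattice_coeff_torus_char:
  assumes "M > 0"
  shows "lattice_coeff z M (torus_char h) k = (if int M dvd int_dot (h - k) z then 1 else 0)"
proof -
  define n where "n = int_dot (h - k) z"
  define w where "w = cis (2 * pi * (of_int n / of_nat M))"
  have "lattice_coeff z M (torus_char h) k = (1 / of_nat M) * (\<Sum>j<M. w ^ j)"
    unfolding lattice_coeff_def cnj_torus_char torus_char_add[symmetric]
    by (simp only: torus_char_lattice_node w_def n_def diff_conv_add_uminus)
  also have "\<dots> = (if int M dvd n then 1 else 0)"
  proof (cases "int M dvd n")
    case True
    then obtain m where "n = int M * m" ..
    then have "w = 1"
      using assms cis_multiple_2pi[of "of_int m"] by (simp add: w_def)
    then show ?thesis
      using True assms by simp
  next
    case False
    have "w ^ M = cis (2 * pi * of_int n)"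
      using assms by (simp add: w_def Complex.DeMoivre)
    also have "\<dots> = 1"
      by (intro cis_multiple_2pi) auto
    finally have "w ^ M = 1" .
    moreover have "w \<noteq> 1"
    proof
      assume "w = 1"
      then have "cos (2 * pi * (of_int n / of_nat M)) = 1"
        by (simp add: w_def complex_eq_iff)
      then obtain m :: int where "2 * pi * (of_int n / of_nat M) = of_int m * 2 * pi"
        unfolding cos_one_2pi_int by blast
      then have "real_of_int n = of_int m * of_nat M"
        using assms by (simp add: field_simps)
      then have "n = m * int M"
        by (metis of_int_eq_iff of_int_mult of_int_of_nat_eq)
      then show False
        using False by simp
    qed
    ultimately show ?thesis
      using False by (simp add: geometric_sum)
  qed
  finally show ?thesis
    by (simp add: n_def)
qed

lemma lattice_sampling_linear:
  "lattice_sampling I z M (\<lambda>x. \<Sum>h\<in>F. c h * g h x) x = (\<Sum>h\<in>F. c h * lattice_sampling I z M (g h) x)"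
proof -
  have "lattice_coeff z M (\<lambda>x. \<Sum>h\<in>F. c h * g h x) k = (\<Sum>h\<in>F. c h * lattice_coeff z M (g h) k)" for k
    unfolding lattice_coeff_def sum_distrib_right sum_distrib_left
    by (subst sum.swap) (simp add: mult_ac)
  then show ?thesis
    unfolding lattice_sampling_def sum_distrib_right sum_distrib_left
    by (subst sum.swap) (simp add: sum_distrib_right sum_distrib_left mult_ac)
qed

lemma continuous_on_lattice_sampling [continuous_intros]:
  "continuous_on S (lattice_sampling I z M f)"
  unfolding lattice_sampling_def by (intro continuous_intros)

lemma reconstructing_lattice_torus_char:
  assumes "reconstructing_lattice I z M" "finite I" "h \<in> I"
  shows "lattice_sampling I z M (torus_char h) = torus_char h"
proof -
  have eq: "(\<lambda>x. \<Sum>k\<in>I. (if k = h then 1 else 0) * torus_char k x) = torus_char h"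
    using assms by (simp add: fun_eq_iff if_distrib[of "\<lambda>c. c * _"] cong: if_cong)
  show ?thesis
    using assms(1)[unfolded reconstructing_lattice_def, rule_format, of "\<lambda>k. if k = h then 1 else 0"]
    unfolding eq .
qed

text \<open>Evaluating the reconstruction of a single character at the origin counts the frequencies
  of \<open>I\<close> that are aliased to it.\<close>

lemma reconstructing_lattice_inj:
  assumes rec: "reconstructing_lattice I z M" and "finite I" "M > 0" "h \<in> I" "k \<in> I"
    and "int M dvd int_dot (h - k) z"
  shows "k = h"
proof -
  define A where "A = {k \<in> I. int M dvd int_dot (h - k) z}"
  have "of_nat (card A) = lattice_sampling I z M (torus_char h) 0"
    using assms by (simp add: lattice_sampling_def lattice_coeff_torus_char A_def sum.If_cases Int_def)
  also have "\<dots> = 1"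
    using assms by (simp add: reconstructing_lattice_torus_char)
  finally have "card A = 1"
    by simp
  then obtain l where "A = {l}"
    by (rule card_1_singletonE)
  moreover have "h \<in> A" "k \<in> A"
    using assms by (auto simp: A_def int_dot_def)
  ultimately show ?thesis
    by auto
qed

text \<open>For h outside I, two frequencies of I aliased to h would be aliased to each other, so
  there is at most one. The sample is then 0 or a single character, and the triangle inequality
  gives 2.\<close>

lemma aliasing_error_torus_char:
  assumes rec: "reconstructing_lattice I z M" and "finite I" "M > 0"
  shows "norm (torus_char h x - lattice_sampling I z M (torus_char h) x) \<le> (if h \<in> I then 0 else 2)"
proof (cases "h \<in> I")
  case True
  then show ?thesis
    using assms by (simp add: reconstructing_lattice_torus_char)
next
  case False
  define A where "A = {k \<in> I. int M dvd int_dot (h - k) z}"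
  have eq: "k = k'" if "k \<in> A" "k' \<in> A" for k k'
  proof -
    have "int M dvd int_dot (h - k) z - int_dot (h - k') z"
      using that by (intro dvd_diff) (auto simp: A_def)
    then have "int M dvd int_dot (k' - k) z"
      by (simp add: int_dot_diff)
    then show ?thesis
      using that reconstructing_lattice_inj[OF assms, of k' k] by (auto simp: A_def)
  qed
  have "norm (lattice_sampling I z M (torus_char h) x) = norm (\<Sum>k\<in>A. torus_char k x)"
    using assms
    by (simp add: lattice_sampling_def lattice_coeff_torus_char A_def if_distrib[of "\<lambda>c. c * _"]
        sum.If_cases Int_def cong: if_cong)
  also have "\<dots> \<le> real (card A)"
    by (rule order_trans[OF norm_sum]) simp
  also have "\<dots> \<le> 1"
    using card_le_Suc0_iff_eq[of A] eq assms(2) by (simp add: A_def)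
  finally have "norm (lattice_sampling I z M (torus_char h) x) \<le> 1" .
  then show ?thesis
    using False norm_triangle_ineq4[of "torus_char h x" "lattice_sampling I z M (torus_char h) x"]
    by simp
qed

section \<open>From the weight tail to the operator norm\<close>

text \<open>Cauchy-Schwarz after multiplying and dividing each term by the square root of the
  weight.\<close>

lemma sum_fourier_coeff_le:
  fixes f :: "real ^ 'n::finite \<Rightarrow> complex"
  assumes "f \<in> hybrid_space \<alpha> \<beta>" "finite F"
    and B: "(\<Sum>k\<in>F. 1 / hybrid_weight \<alpha> \<beta> k) \<le> B"
  shows "(\<Sum>k\<in>F. norm (fourier_coeff f k)) \<le> hybrid_norm \<alpha> \<beta> f * sqrt B"
proof -
  let ?w = "hybrid_weight \<alpha> \<beta> :: int ^ 'n \<Rightarrow> real"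
  have w: "?w k > 0" for k
    by (rule hybrid_weight_pos)
  have "(\<Sum>k\<in>F. norm (fourier_coeff f k))
      = (\<Sum>k\<in>F. \<bar>norm (fourier_coeff f k) * sqrt (?w k)\<bar> * \<bar>1 / sqrt (?w k)\<bar>)"
    using less_imp_neq[OF w] less_imp_le[OF w] by (intro sum.cong refl) (simp add: abs_mult)
  also have "\<dots> \<le> L2_set (\<lambda>k. norm (fourier_coeff f k) * sqrt (?w k)) F * L2_set (\<lambda>k. 1 / sqrt (?w k)) F"
    by (rule L2_set_mult_ineq)
  also have "\<dots> = sqrt (\<Sum>k\<in>F. (norm (fourier_coeff f k))\<^sup>2 * ?w k) * sqrt (\<Sum>k\<in>F. 1 / ?w k)"
    using w[THEN less_imp_le] by (simp add: L2_set_def power_mult_distrib power_divide)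
  also have "\<dots> \<le> hybrid_norm \<alpha> \<beta> f * sqrt B"
  proof (intro mult_mono real_sqrt_le_mono B)
    have "(\<Sum>k\<in>F. (norm (fourier_coeff f k))\<^sup>2 * ?w k) \<le> (\<Sum>\<^sub>\<infinity>k. (norm (fourier_coeff f k))\<^sup>2 * ?w k)"
      using assms w[THEN less_imp_le] by (intro finite_sum_le_infsum) (auto simp: hybrid_space_def)
    then show "sqrt (\<Sum>k\<in>F. (norm (fourier_coeff f k))\<^sup>2 * ?w k) \<le> hybrid_norm \<alpha> \<beta> f"
      by (simp add: hybrid_norm_def)
    show "0 \<le> hybrid_norm \<alpha> \<beta> f"
      using w[THEN less_imp_le] by (auto simp: hybrid_norm_def intro!: infsum_nonneg)
  qed (use w[THEN less_imp_le] in \<open>auto intro!: sum_nonneg\<close>)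
  finally show ?thesis .
qed

text \<open>On a finite partial Fourier sum the error is a combination of single-character errors,
  and only frequencies outside I contribute. The bound is uniform in the partial sum and survives
  the limit.\<close>

lemma sampling_error_pointwise:
  fixes f :: "real ^ 'n::finite \<Rightarrow> complex"
  assumes f: "f \<in> hybrid_space \<alpha> \<beta>" "continuous_on UNIV f" "hybrid_norm \<alpha> \<beta> f \<le> 1"
    and rec: "reconstructing_lattice I z M" "finite I" "M > 0"
    and B: "\<And>F. finite F \<Longrightarrow> F \<inter> I = {} \<Longrightarrow> (\<Sum>k\<in>F. 1 / hybrid_weight \<alpha> \<beta> k) \<le> B"
  shows "norm (f x - lattice_sampling I z M f x) \<le> 2 * sqrt B"
proof -
  define c where "c = fourier_coeff f"
  have "0 \<le> B"
    using B[of "{}"] by simp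
  have tail: "(\<Sum>k\<in>F. norm (c k)) \<le> sqrt B" if "finite F" "F \<inter> I = {}" for F
  proof -
    have "(\<Sum>k\<in>F. norm (c k)) \<le> hybrid_norm \<alpha> \<beta> f * sqrt B"
      unfolding c_def using f that by (intro sum_fourier_coeff_le B)
    also have "\<dots> \<le> 1 * sqrt B"
      using f \<open>0 \<le> B\<close> by (intro mult_right_mono) auto
    finally show ?thesis
      by simp
  qed
  \<comment> \<open>Absolute summability: the finitely many coefficients in I are added to the tail
    bound, giving a bound common to all finite F.\<close>
  have "(\<Sum>k\<in>F. norm (c k)) \<le> (\<Sum>k\<in>I. norm (c k)) + sqrt B" if "finite F" for F
  proof -
    have "(\<Sum>k\<in>F. norm (c k)) = (\<Sum>k\<in>F \<inter> I. norm (c k)) + (\<Sum>k\<in>F - I. norm (c k))"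
      using that by (rule sum.Int_Diff)
    also have "\<dots> \<le> (\<Sum>k\<in>I. norm (c k)) + sqrt B"
      using that rec by (intro add_mono sum_mono2 tail) auto
    finally show ?thesis .
  qed
  then have "(\<lambda>k. norm (c k)) summable_on UNIV"
    by (intro nonneg_bdd_above_summable_on) (auto intro!: bdd_aboveI)
  moreover have "periodic f"
    using f by (simp add: hybrid_space_def L2_torus_def)
  ultimately have inv: "((\<lambda>F. \<Sum>k\<in>F. c k * torus_char k y) \<longlongrightarrow> f y) (finite_subsets_at_top UNIV)" for y
    using fourier_inversion[OF f(2), of y] by (simp add: has_sum_def c_def)
  define p where "p F y = (\<Sum>k\<in>F. c k * torus_char k y)" for F y
  note inv = inv[folded p_def]
  \<comment> \<open>Sampling uses finitely many nodes and frequencies, so pointwise convergence of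
    the partial sums passes through it.\<close>
  have "((\<lambda>F. p F x - lattice_sampling I z M (p F) x) \<longlongrightarrow> f x - lattice_sampling I z M f x)
      (finite_subsets_at_top UNIV)"
    unfolding lattice_sampling_def lattice_coeff_def by (intro tendsto_intros inv)
  moreover have "\<forall>\<^sub>F F in finite_subsets_at_top UNIV.
      norm (p F x - lattice_sampling I z M (p F) x) \<le> 2 * sqrt B"
  proof (rule eventually_finite_subsets_at_top_weakI)
    fix F :: "(int ^ 'n) set" assume F: "finite F"
    have "p F x - lattice_sampling I z M (p F) x
        = (\<Sum>k\<in>F. c k * (torus_char k x - lattice_sampling I z M (torus_char k) x))"
      unfolding p_def lattice_sampling_linear by (simp add: right_diff_distrib sum_subtractf)
    also have "norm \<dots> \<le> (\<Sum>k\<in>F. norm (c k) * (if k \<in> I then 0 else 2))"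
      by (intro sum_norm_le) (simp only: norm_mult, intro mult_left_mono aliasing_error_torus_char rec norm_ge_zero)
    also have "\<dots> = 2 * (\<Sum>k\<in>F - I. norm (c k))"
      using F by (simp add: if_distrib[of "\<lambda>u. _ * u"] sum.If_cases sum_distrib_left Diff_eq mult.commute
          cong: if_cong)
    also have "\<dots> \<le> 2 * sqrt B"
      using F by (intro mult_left_mono tail) auto
    finally show "norm (p F x - lattice_sampling I z M (p F) x) \<le> 2 * sqrt B" .
  qed
  ultimately show ?thesis
    by (rule Lim_norm_ubound[rotated]) simp
qed

lemma hybrid_Linf_opnorm_sampling_le:
  fixes I :: "(int ^ 'n::finite) set"
  assumes rec: "reconstructing_lattice I z M" "finite I" "M > 0"
    and B: "\<And>F. finite F \<Longrightarrow> F \<inter> I = {} \<Longrightarrow> (\<Sum>k\<in>F. 1 / hybrid_weight \<alpha> \<beta> k) \<le> B"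
  shows "hybrid_Linf_opnorm \<alpha> \<beta> (\<lambda>f x. f x - lattice_sampling I z M f x) \<le> ennreal (2 * sqrt B)"
  unfolding hybrid_Linf_opnorm_def
proof (rule SUP_least)
  fix f :: "real ^ 'n \<Rightarrow> complex"
  assume f: "f \<in> {f \<in> hybrid_space \<alpha> \<beta>. continuous_on UNIV f \<and> hybrid_norm \<alpha> \<beta> f \<le> 1}"
  have "continuous_on UNIV (\<lambda>x. norm (f x - lattice_sampling I z M f x))"
    using f by (intro continuous_intros) auto
  then have "(\<lambda>x. ennreal (norm (f x - lattice_sampling I z M f x))) \<in> borel_measurable torus_measure"
    by (intro measurable_compose[OF continuous_imp_measurable_torus measurable_ennreal])
  then show "Linf_norm (\<lambda>x. f x - lattice_sampling I z M f x) \<le> ennreal (2 * sqrt B)"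
    unfolding Linf_norm_def using f
    by (intro esssup_I AE_I2 ennreal_leI sampling_error_pointwise[OF _ _ _ rec B]) auto
qed

section \<open>Lattice size and the rate in terms of M\<close>

lemma two_powr_le_card_hyperbolic_cross:
  fixes T R :: real
  assumes T: "0 \<le> T" "T < 1" and R: "R \<ge> 1" and d: "CARD('n::finite) \<ge> 2"
  shows "2 powr R \<le> real (card (hyperbolic_cross T R :: (int ^ 'n) set))"
proof -
  define N where "N = nat \<lceil>R\<rceil>"
  have N: "R \<le> real N" "real N \<le> R + 1"
    using R by (auto simp: N_def)
  \<comment> \<open>An arbitrary coordinate.\<close>
  define s :: 'n where "s = undefined"
  have "axis s n \<in> hyperbolic_cross T R" if n: "n \<in> {1..2 ^ N}" for n
  proof -
    define j :: "nat ^ 'n" where "j = axis s (dyadic_level n)"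
    have le: "dyadic_level n \<le> N"
      unfolding dyadic_level_def using n by (intro Least_le) auto
    have "(\<Sum>i\<in>UNIV. j $ i) = dyadic_level n"
      by (simp add: j_def axis_def if_distrib cong: if_cong)
    moreover have "Max (range (\<lambda>i. j $ i)) = dyadic_level n"
      by (intro Max_eqI) (auto simp: j_def axis_def intro!: image_eqI[of _ _ s])
    moreover have "(1 - T) * real (dyadic_level n) \<le> (1 - T) * (R + 1)"
      using T le N by (intro mult_left_mono) auto
    moreover have "(1 - T) * (R + 1) \<le> (1 - T) * R + real CARD('n) - 1"
      using T d by (simp add: algebra_simps)
    ultimately have "j \<in> hc_levels T R"
      by (simp add: hc_levels_def algebra_simps del: of_nat_sum)
    moreover have "axis s n $ i \<in> dyadic_block (j $ i)" for i
      by (cases "i = s") (simp_all add: j_def axis_def mem_dyadic_block_level, simp add: dyadic_block_def)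
    ultimately show ?thesis
      unfolding hyperbolic_cross_def by blast
  qed
  then have "card (axis s ` {1..2 ^ N :: int}) \<le> card (hyperbolic_cross T R :: (int ^ 'n) set)"
    using finite_hyperbolic_cross[OF T] by (intro card_mono) auto
  also have "card (axis s ` {1..2 ^ N :: int}) = 2 ^ N"
    by (subst card_image) (auto simp: inj_on_def axis_eq_axis nat_power_eq)
  finally have "real (2 ^ N) \<le> real (card (hyperbolic_cross T R :: (int ^ 'n) set))"
    by (rule of_nat_mono)
  moreover have "2 powr R \<le> real (2 ^ N)"
    using N by (simp flip: powr_realpow)
  ultimately show ?thesis
    by (rule order_trans[rotated])
qed

lemma cbc_constructed_pos:
  assumes "cbc_constructed I z M"
  shows "M > 0"
  using assms by (force simp: cbc_constructed_def)

text \<open>At the last component the projection is the identity, so the search condition says that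
  the elements of I have distinct residues modulo M.\<close>

lemma card_le_cbc_constructed:
  fixes I :: "((int, 'n::{finite,linorder}) vec) set"
  assumes "cbc_constructed I z M"
  shows "card I \<le> M"
proof -
  define s where "s = Max (UNIV :: 'n set)"
  have "cbc_projection s = (id :: (int, 'n) vec \<Rightarrow> _)"
    by (simp add: fun_eq_iff vec_eq_iff cbc_projection_def s_def)
  then have "card I = card ((\<lambda>k. int_dot k z mod int M) ` I)"
    using assms by (metis cbc_constructed_def image_id id_apply)
  also have "\<dots> \<le> card {0..<int M}"
    using cbc_constructed_pos[OF assms] by (intro card_mono) auto
  finally show ?thesis
    by simp
qed

text \<open>Raising the upper bound on M to the power - \<gamma> / 2 turns it into a lower bound for
  M powr (- \<gamma> / 2), with a loss of R powr (e * \<gamma> / 2). The lower bound on M gives R *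
  ln 2 \<le> ln M, and the logarithmic factor makes up for that loss and for R powr q.\<close>

lemma refinement_rate_le_size_rate:
  fixes C R e \<gamma> q :: real and M :: nat
  assumes pos: "C > 0" "R \<ge> 1" "\<gamma> > 0" "q \<ge> 0" "e \<ge> 0"
    and lower: "2 powr R \<le> real M" and upper: "real M \<le> C * 2 powr (2 * R) * R powr e"
  shows "2 powr (- \<gamma> * R) * R powr q
    \<le> C powr (\<gamma> / 2) * ln 2 powr (- (e * \<gamma> / 2 + q)) *
        (real M powr (- \<gamma> / 2) * ln (real M) powr (e * \<gamma> / 2 + q))"
proof -
  define p where "p = e * \<gamma> / 2 + q"
  have p: "p \<ge> 0"
    using pos by (simp add: p_def)
  have M: "real M > 0"
    using lower by (rule less_le_trans[rotated]) simp
  have "ln (2 powr R) \<le> ln (real M)"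
    using lower M by (subst ln_le_cancel_iff) auto
  then have "(R * ln 2) powr p \<le> ln (real M) powr p"
    using pos p by (intro powr_mono2) (auto simp: ln_powr)
  then have "R powr p * ln 2 powr p \<le> ln (real M) powr p"
    using pos by (simp add: powr_mult)
  moreover have "(C * 2 powr (2 * R) * R powr e) powr (- \<gamma> / 2) \<le> real M powr (- \<gamma> / 2)"
    using upper M pos by (intro powr_mono2') auto
  then have "C powr (- \<gamma> / 2) * 2 powr (- \<gamma> * R) * R powr (- (e * \<gamma> / 2)) \<le> real M powr (- \<gamma> / 2)"
    using pos by (simp add: powr_mult powr_powr mult_ac)
  ultimately have "(C powr (- \<gamma> / 2) * 2 powr (- \<gamma> * R) * R powr (- (e * \<gamma> / 2))) * (R powr p * ln 2 powr p)
      \<le> real M powr (- \<gamma> / 2) * ln (real M) powr p"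
    by (intro mult_mono) auto
  then have "C powr (\<gamma> / 2) * ln 2 powr (- p) *
      ((C powr (- \<gamma> / 2) * 2 powr (- \<gamma> * R) * R powr (- (e * \<gamma> / 2))) * (R powr p * ln 2 powr p))
      \<le> C powr (\<gamma> / 2) * ln 2 powr (- p) * (real M powr (- \<gamma> / 2) * ln (real M) powr p)"
    by (intro mult_left_mono) auto
  also have "C powr (\<gamma> / 2) * ln 2 powr (- p) *
      ((C powr (- \<gamma> / 2) * 2 powr (- \<gamma> * R) * R powr (- (e * \<gamma> / 2))) * (R powr p * ln 2 powr p))
      = (C powr (\<gamma> / 2) * C powr (- \<gamma> / 2)) * (ln 2 powr (- p) * ln 2 powr p) *
        (2 powr (- \<gamma> * R) * (R powr (- (e * \<gamma> / 2)) * R powr p))"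
    by (simp only: mult_ac)
  also have "\<dots> = 2 powr (- \<gamma> * R) * R powr q"
    using pos by (simp add: p_def flip: powr_add)
  finally show ?thesis
    by (simp add: p_def)
qed

text \<open>The order of quantifiers makes c independent of R, z and M; in the second estimate it
  may depend on the constant C of the size guarantee.\<close>

theorem proposition4p9:
  fixes \<alpha> \<beta> T :: real
  assumes "\<alpha> > 1/2" and "\<beta> \<le> 0" and "\<alpha> + \<beta> > 1/2"
    and "T = - \<beta> / \<alpha>"
    and "CARD('n::{finite,linorder}) \<ge> 2"
  shows
    "(\<exists>c>0. \<forall>R\<ge>1. \<forall>(z :: (int, 'n) vec) M.
        reconstructing_lattice (hyperbolic_cross T R) z M \<and>
        cbc_constructed (hyperbolic_cross T R) z M
        \<longrightarrow>
        hybrid_Linf_opnorm \<alpha> \<beta>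
            (\<lambda>f x. f x - lattice_sampling (hyperbolic_cross T R) z M f x)
          \<le> ennreal (c * (2 powr (- (\<alpha> + \<beta> - 1/2) * R) *
                 (if \<beta> = 0 then R powr ((real CARD('n) - 1) / 2) else 1))))
     \<and>
     (\<forall>C>0. \<exists>c>0. \<forall>R\<ge>1. \<forall>(z :: (int, 'n) vec) M.
        reconstructing_lattice (hyperbolic_cross T R) z M \<and>
        cbc_constructed (hyperbolic_cross T R) z M \<and>
        cbc_size_bound C CARD('n) T R M
        \<longrightarrow>
        2 powr (- (\<alpha> + \<beta> - 1/2) * R) *
            (if \<beta> = 0 then R powr ((real CARD('n) - 1) / 2) else 1)
          \<le> c * (real M powr (- (\<alpha> + \<beta> - 1/2) / 2) *
                 (if \<beta> = 0
                  then ln (real M) powr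
                         ((real CARD('n) - 2) / 2 * (\<alpha> - 1/2) + (real CARD('n) - 1) / 2)
                  else 1)))"
proof -
  have T: "0 \<le> T" "T < 1" and T_0: "T = 0 \<longleftrightarrow> \<beta> = 0"
    unfolding assms(4) using assms(1-3)
    by (simp_all add: divide_nonpos_pos pos_divide_less_eq del: minus_divide_left divide_minus_left)
  define \<gamma> where "\<gamma> = \<alpha> + \<beta> - 1/2"
  have \<gamma>: "\<gamma> > 0"
    using assms by (simp add: \<gamma>_def)
  \<comment> \<open>The case split on \<beta> is moved into the exponents q and e, which are 0 for
    \<beta> < 0; R powr 0 = 1 because R \<ge> 1.\<close>
  define q where "q = (if \<beta> = 0 then (real CARD('n) - 1) / 2 else 0)"
  define e where "e = (if \<beta> = 0 then real CARD('n) - 2 else 0)"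
  have q: "q \<ge> 0" and e: "e \<ge> 0"
    using assms by (auto simp: q_def e_def)
  have R_q: "(if \<beta> = 0 then R powr ((real CARD('n) - 1) / 2) else 1) = R powr q" if "R \<ge> 1" for R
    using that by (simp add: q_def)
  obtain K where K: "K > 0"
    and tail: "\<And>R F. R \<ge> 1 \<Longrightarrow> finite F \<Longrightarrow> F \<inter> hyperbolic_cross T R = {} \<Longrightarrow>
      (\<Sum>k\<in>F. 1 / hybrid_weight \<alpha> \<beta> (k :: (int, 'n) vec))
        \<le> K * (2 powr (- (2 * (\<alpha> + \<beta>) - 1) * R) * (if \<beta> = 0 then R ^ (CARD('n) - 1) else 1))"
    using sum_outside_hyperbolic_cross_le[OF assms(1-4), where 'n = 'n] by blast
  have opnorm: "hybrid_Linf_opnorm \<alpha> \<beta> (\<lambda>f x. f x - lattice_sampling (hyperbolic_cross T R) z M f x)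
      \<le> ennreal (2 * sqrt K * (2 powr (- \<gamma> * R) * R powr q))"
    if R: "R \<ge> 1" and rec: "reconstructing_lattice (hyperbolic_cross T R) z M"
      and cbc: "cbc_constructed (hyperbolic_cross T R) z M" for R and z :: "(int, 'n) vec" and M
  proof -
    have "hybrid_Linf_opnorm \<alpha> \<beta> (\<lambda>f x. f x - lattice_sampling (hyperbolic_cross T R) z M f x)
        \<le> ennreal (2 * sqrt (K * (2 powr (- (2 * (\<alpha> + \<beta>) - 1) * R) *
            (if \<beta> = 0 then R ^ (CARD('n) - 1) else 1))))"
      using finite_hyperbolic_cross[OF T] cbc_constructed_pos[OF cbc] tail[OF R]
      by (intro hybrid_Linf_opnorm_sampling_le rec)
    \<comment> \<open>The tail bound is the square of the claimed rate, so the root can be taken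
      exactly.\<close>
    also have "2 powr (- (2 * (\<alpha> + \<beta>) - 1) * R) * (if \<beta> = 0 then R ^ (CARD('n) - 1) else 1)
        = (2 powr (- \<gamma> * R) * R powr q)\<^sup>2"
    proof -
      have "(2 powr (- \<gamma> * R))\<^sup>2 = 2 powr (- (2 * (\<alpha> + \<beta>) - 1) * R)"
        by (simp add: power2_eq_square \<gamma>_def algebra_simps flip: powr_add)
      moreover have "(R powr q)\<^sup>2 = (if \<beta> = 0 then R ^ (CARD('n) - 1) else 1)"
        using R assms(5) by (simp add: power2_eq_square q_def of_nat_diff diff_divide_distrib flip: powr_add powr_realpow)
      ultimately show ?thesis
        by (simp add: power_mult_distrib)
    qed
    finally show ?thesis
      by (simp add: real_sqrt_mult mult.assoc)
  qed
  have size: "2 powr (- \<gamma> * R) * (if \<beta> = 0 then R powr ((real CARD('n) - 1) / 2) else 1)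
      \<le> C powr (\<gamma> / 2) * ln 2 powr (- (e * \<gamma> / 2 + q)) *
        (real M powr (- \<gamma> / 2) *
          (if \<beta> = 0
           then ln (real M) powr ((real CARD('n) - 2) / 2 * (\<alpha> - 1/2) + (real CARD('n) - 1) / 2)
           else 1))"
    if "C > 0" and R: "R \<ge> 1" and cbc: "cbc_constructed (hyperbolic_cross T R) z M"
      and bound: "cbc_size_bound C CARD('n) T R M" for C R and z :: "(int, 'n) vec" and M
  proof -
    have M: "2 powr R \<le> real M"
      using two_powr_le_card_hyperbolic_cross[OF T R assms(5)] card_le_cbc_constructed[OF cbc] by linarith
    moreover have "real M \<le> C * 2 powr (2 * R) * R powr e"
      using bound R by (cases "\<beta> = 0") (simp_all add: cbc_size_bound_def T_0 e_def)
    ultimately have bound_q: "2 powr (- \<gamma> * R) * R powr q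
        \<le> C powr (\<gamma> / 2) * ln 2 powr (- (e * \<gamma> / 2 + q)) *
          (real M powr (- \<gamma> / 2) * ln (real M) powr (e * \<gamma> / 2 + q))"
      using that \<gamma> q e by (intro refinement_rate_le_size_rate) auto
    have ln_M: "ln (real M) powr (e * \<gamma> / 2 + q)
        = (if \<beta> = 0
           then ln (real M) powr ((real CARD('n) - 2) / 2 * (\<alpha> - 1/2) + (real CARD('n) - 1) / 2)
           else 1)"
    proof -
      \<comment> \<open>For \<beta> < 0 the factor \<open>ln (real M) powr 0\<close> has to be 1,
        which requires ln M to be nonzero; this follows from M \<ge> 2.\<close>
      have "2 \<le> 2 powr R"
        using R powr_mono[of 1 R 2] by simp
      then have "1 < real M"
        using M by linarith
      then have "ln (real M) > 0"
        by (rule ln_gt_zero)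
      then show ?thesis
        by (simp add: e_def q_def \<gamma>_def)
    qed
    show ?thesis
      using bound_q unfolding R_q[OF R] ln_M .
  qed
  show ?thesis
    unfolding \<gamma>_def[symmetric]
  proof (intro conjI allI impI)
    show "\<exists>c>0. \<forall>R\<ge>1. \<forall>(z :: (int, 'n) vec) M.
        reconstructing_lattice (hyperbolic_cross T R) z M \<and>
        cbc_constructed (hyperbolic_cross T R) z M
        \<longrightarrow>
        hybrid_Linf_opnorm \<alpha> \<beta>
            (\<lambda>f x. f x - lattice_sampling (hyperbolic_cross T R) z M f x)
          \<le> ennreal (c * (2 powr (- \<gamma> * R) *
                 (if \<beta> = 0 then R powr ((real CARD('n) - 1) / 2) else 1)))"
      using K opnorm by (intro exI[of _ "2 * sqrt K"]) (simp add: R_q)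
    fix C :: real assume "C > 0"
    then show "\<exists>c>0. \<forall>R\<ge>1. \<forall>(z :: (int, 'n) vec) M.
        reconstructing_lattice (hyperbolic_cross T R) z M \<and>
        cbc_constructed (hyperbolic_cross T R) z M \<and>
        cbc_size_bound C CARD('n) T R M
        \<longrightarrow>
        2 powr (- \<gamma> * R) *
            (if \<beta> = 0 then R powr ((real CARD('n) - 1) / 2) else 1)
          \<le> c * (real M powr (- \<gamma> / 2) *
                 (if \<beta> = 0
                  then ln (real M) powr
                         ((real CARD('n) - 2) / 2 * (\<alpha> - 1/2) + (real CARD('n) - 1) / 2)
                  else 1))"
      by (intro exI[of _ "C powr (\<gamma> / 2) * ln 2 powr (- (e * \<gamma> / 2 + q))"] conjI allI impI)
         (simp, elim conjE, rule size)
  qed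
qed

end
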